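(* Let $R_1,R_2:[0,\pi/2]\to(0,+\infty)$ be Lipschitz functions with $\inf R_1>1$ and $\inf R_2>\sup R_1$, and such that $R_1'$ is a function of bounded variation. In polar coordinates of the plane, let $$\Omega=\{(r,\theta):0<r<1,\ 0<\theta<\pi/2\},\qquad \Omega'=\{(r,\theta):R_1(\theta)<r<R_2(\theta),\ 0<\theta<\pi/2\}.$$ Let $\mu\in\mathcal P(\Omega)$, $\nu\in\mathcal P(\Omega')$ have densities $f,g$ which are Lipschitz and bounded from above and from below by positive constants on $\overline\Omega$, $\overline{\Omega'}$ respectively, and assume that for every $\theta\in(0,\pi/2)$, $\int_0^1 f(r,\theta)\,r\,dr=\int_{R_1(\theta)}^{R_2(\theta)}g(r,\theta)\,r\,dr$. Let $T$ be a transport map from $\mu$ to $\nu$ such that $F(T)<+\infty$ and write $T(x)=\phi(r,\theta)\frac{x}{|x|}$. Then the function $r\mapsto\phi(r,\cdot)$ is continuous from $[0,1]$ to $L^2(0,\pi/2)$ and satisfies $\phi(0,\cdot)=\Phi$.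
   Context: $W_1=\min\{\int_\Omega|T(x)-x|\,d\mu(x):T_\#\mu=\nu\}$ and $\mathcal O_1(\mu,\nu)$ is the set of transport maps (maps with $T_\#\mu=\nu$) attaining this minimum. In the present setting every $T\in\mathcal O_1(\mu,\nu)$ has the form $T(x)=\phi(r,\theta)\frac{x}{|x|}$ for a.e. $x=(r,\theta)\in\Omega$, with $\phi$ a positive scalar function. $\|\phi\|_{H^1(0,\pi/2)}^2=\int_0^{\pi/2}(\phi^2+\phi'^2)\,d\theta$ (equal to $+\infty$ if $\phi\notin H^1(0,\pi/2)$). $K$ is the minimum, and $\Phi$ the unique minimizer, of $\int_0^{\pi/2}(\phi^2+\phi'^2)\,d\theta$ among $\phi\in H^1(0,\pi/2)$ with $R_1\le\phi\le R_2$. The functional $F$ is defined by $F(T)=+\infty$ if $T\notin\mathcal O_1(\mu,\nu)$ and, for $T\in\mathcal O_1(\mu,\nu)$ with $T(x)=\phi(r,\theta)\frac{x}{|x|}$, $$F(T)=\int_0^1\frac{\|\phi(r,\cdot)\|_{H^1(0,\pi/2)}^2-K}{r}\,dr+\int_0^1\|\partial_r\phi(r,\cdot)\|_{L^2(0,\pi/2)}^2\,r\,dr,$$ with weak derivatives (a term being $+\infty$ if the corresponding derivative does not exist as a function with finite integral). Since $\phi$ is defined up to null sets, continuity of $r\mapsto\phi(r,\cdot)$ on $[0,1]$ means that it has a representative on $(0,1)$ extending continuously to $[0,1]$ with values in $L^2(0,\pi/2)$, and $\phi(0,\cdot)$ is the value at $0$ of this extension. *)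

theory Defs
  imports "HOL-Analysis.Analysis" "HOL-Probability.Probability_Measure"
begin

subsection \<open>Weak derivatives\<close>

primrec Ck_function :: "nat \<Rightarrow> ('a::euclidean_space \<Rightarrow> real) \<Rightarrow> bool" where
  "Ck_function 0 f \<longleftrightarrow> continuous_on UNIV f"
| "Ck_function (Suc k) f \<longleftrightarrow> (\<forall>x. f differentiable (at x)) \<and>
     (\<forall>v. Ck_function k (\<lambda>x. frechet_derivative f (at x) v))"

definition test_function :: "'a::euclidean_space set \<Rightarrow> ('a \<Rightarrow> real) \<Rightarrow> bool" where
  "test_function U \<psi> \<longleftrightarrow> (\<forall>k. Ck_function k \<psi>) \<and>
     compact (closure {x. \<psi> x \<noteq> 0}) \<and> closure {x. \<psi> x \<noteq> 0} \<subseteq> U"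

definition locally_integrable_on :: "('a::euclidean_space \<Rightarrow> real) \<Rightarrow> 'a set \<Rightarrow> bool" where
  "locally_integrable_on u U \<longleftrightarrow> (\<forall>C. compact C \<and> C \<subseteq> U \<longrightarrow> u absolutely_integrable_on C)"

text \<open>\<open>w\<close> is the weak derivative of \<open>u\<close> on the open set \<open>U\<close> in the direction \<open>v\<close>.\<close>

definition has_weak_derivative ::
    "('a::euclidean_space \<Rightarrow> real) \<Rightarrow> ('a \<Rightarrow> real) \<Rightarrow> 'a \<Rightarrow> 'a set \<Rightarrow> bool" where
  "has_weak_derivative u w v U \<longleftrightarrow>
     locally_integrable_on u U \<and> locally_integrable_on w U \<and>
     (\<forall>\<psi>. test_function U \<psi> \<longrightarrow>
        (LINT x:U|lebesgue. u x * frechet_derivative \<psi> (at x) v) =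
        - (LINT x:U|lebesgue. w x * \<psi> x))"


subsection \<open>The spaces \<open>L\<^sup>2(0,\<pi>/2)\<close> and \<open>H\<^sup>1(0,\<pi>/2)\<close>\<close>

abbreviation angles :: "real set" where
  "angles \<equiv> {0<..<pi/2}"

definition L2_norm_sq :: "(real \<Rightarrow> real) \<Rightarrow> ennreal" where
  "L2_norm_sq u = (\<integral>\<^sup>+\<theta>\<in>angles. ennreal ((u \<theta>)\<^sup>2) \<partial>lebesgue)"

definition in_L2 :: "(real \<Rightarrow> real) \<Rightarrow> bool" where
  "in_L2 u \<longleftrightarrow> u \<in> borel_measurable (lebesgue_on angles) \<and> L2_norm_sq u < \<infinity>"

definition L2_continuous_on :: "real set \<Rightarrow> (real \<Rightarrow> real \<Rightarrow> real) \<Rightarrow> bool" where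
  "L2_continuous_on S \<psi> \<longleftrightarrow> (\<forall>r\<in>S. in_L2 (\<psi> r)) \<and>
     (\<forall>r\<in>S. ((\<lambda>s. L2_norm_sq (\<lambda>\<theta>. \<psi> s \<theta> - \<psi> r \<theta>)) \<longlongrightarrow> 0) (at r within S))"

text \<open>A weak derivative is unique up to null sets, so the infimum ranges over at most one
  value; it is \<open>\<infinity>\<close> if there is no weak derivative.\<close>

definition H1_norm_sq :: "(real \<Rightarrow> real) \<Rightarrow> ennreal" where
  "H1_norm_sq u = (INF u'\<in>{u'. has_weak_derivative u u' 1 angles}.
     (\<integral>\<^sup>+\<theta>\<in>angles. ennreal ((u \<theta>)\<^sup>2 + (u' \<theta>)\<^sup>2) \<partial>lebesgue))"

definition H1_between :: "(real \<Rightarrow> real) \<Rightarrow> (real \<Rightarrow> real) \<Rightarrow> (real \<Rightarrow> real) set" where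
  "H1_between R1 R2 = {u. H1_norm_sq u < \<infinity> \<and>
     (AE \<theta> in lebesgue. \<theta> \<in> angles \<longrightarrow> R1 \<theta> \<le> u \<theta> \<and> u \<theta> \<le> R2 \<theta>)}"

definition H1_min :: "(real \<Rightarrow> real) \<Rightarrow> (real \<Rightarrow> real) \<Rightarrow> ennreal" where
  "H1_min R1 R2 = (INF u\<in>H1_between R1 R2. H1_norm_sq u)"

definition is_H1_minimizer :: "(real \<Rightarrow> real) \<Rightarrow> (real \<Rightarrow> real) \<Rightarrow> (real \<Rightarrow> real) \<Rightarrow> bool" where
  "is_H1_minimizer R1 R2 \<Phi> \<longleftrightarrow> is_arg_min H1_norm_sq (\<lambda>u. u \<in> H1_between R1 R2) \<Phi>"


subsection \<open>Functions of bounded variation\<close>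

definition bounded_variation_on :: "real set \<Rightarrow> (real \<Rightarrow> real) \<Rightarrow> bool" where
  "bounded_variation_on S h \<longleftrightarrow>
     (\<exists>V. \<forall>n (t :: nat \<Rightarrow> real). t ` {..n} \<subseteq> S \<and> mono_on {..n} t \<longrightarrow>
        (\<Sum>i<n. \<bar>h (t (Suc i)) - h (t i)\<bar>) \<le> V)"


subsection \<open>Optimal transport between the two domains\<close>

text \<open>The plane is \<open>complex\<close>, and \<open>rcis r \<theta>\<close> is the point with polar coordinates \<open>(r, \<theta>)\<close>.\<close>

definition Omega :: "complex set" where
  "Omega = {rcis r \<theta> | r \<theta>. 0 < r \<and> r < 1 \<and> 0 < \<theta> \<and> \<theta> < pi/2}"

definition Omega' :: "(real \<Rightarrow> real) \<Rightarrow> (real \<Rightarrow> real) \<Rightarrow> complex set" where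
  "Omega' R1 R2 = {rcis r \<theta> | r \<theta>. R1 \<theta> < r \<and> r < R2 \<theta> \<and> 0 < \<theta> \<and> \<theta> < pi/2}"

text \<open>A probability measure on a domain of the plane is represented as a Borel measure on the
  whole plane that is concentrated on the domain.\<close>

definition transport_maps :: "complex measure \<Rightarrow> complex measure \<Rightarrow> (complex \<Rightarrow> complex) set" where
  "transport_maps \<mu> \<nu> = {T \<in> borel_measurable \<mu>. distr \<mu> borel T = \<nu>}"

definition transport_cost :: "complex measure \<Rightarrow> (complex \<Rightarrow> complex) \<Rightarrow> ennreal" where
  "transport_cost \<mu> T = (\<integral>\<^sup>+x. ennreal (norm (T x - x)) \<partial>\<mu>)"

definition W1 :: "complex measure \<Rightarrow> complex measure \<Rightarrow> ennreal" where
  "W1 \<mu> \<nu> = (INF T\<in>transport_maps \<mu> \<nu>. transport_cost \<mu> T)"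

definition O1 :: "complex measure \<Rightarrow> complex measure \<Rightarrow> (complex \<Rightarrow> complex) set" where
  "O1 \<mu> \<nu> = {T \<in> transport_maps \<mu> \<nu>. transport_cost \<mu> T = W1 \<mu> \<nu>}"

text \<open>\<open>T(x) = \<phi>(r,\<theta>) x/|x|\<close> with \<open>\<phi> > 0\<close>, for almost every \<open>x = (r,\<theta>)\<close> in \<open>Omega\<close>.\<close>

definition radial_profile :: "(complex \<Rightarrow> complex) \<Rightarrow> (real \<Rightarrow> real \<Rightarrow> real) \<Rightarrow> bool" where
  "radial_profile T \<phi> \<longleftrightarrow> (AE x in lebesgue. x \<in> Omega \<longrightarrow>
     \<phi> (norm x) (Arg x) > 0 \<and> T x = \<phi> (norm x) (Arg x) *\<^sub>R (x /\<^sub>R norm x))"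

text \<open>The subtraction of \<open>ennreal\<close> truncates at \<open>0\<close>. This is harmless for profiles of transport
  maps: they satisfy \<open>R1 \<le> \<phi>(r,\<cdot>) \<le> R2\<close> almost everywhere for almost every \<open>r\<close>, hence
  \<open>H1_norm_sq (\<phi> r) \<ge> H1_min R1 R2\<close>. As in \<open>H1_norm_sq\<close>, the infimum in
  \<open>radial_energy\<close> ranges over at most one value.\<close>

definition angular_energy :: "(real \<Rightarrow> real) \<Rightarrow> (real \<Rightarrow> real) \<Rightarrow> (real \<Rightarrow> real \<Rightarrow> real) \<Rightarrow> ennreal" where
  "angular_energy R1 R2 \<phi> =
     (\<integral>\<^sup>+r\<in>{0<..<1}. (H1_norm_sq (\<phi> r) - H1_min R1 R2) / ennreal r \<partial>lebesgue)"

definition radial_energy :: "(real \<Rightarrow> real \<Rightarrow> real) \<Rightarrow> ennreal" where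
  "radial_energy \<phi> =
     (INF w\<in>{w. has_weak_derivative (\<lambda>(r, \<theta>). \<phi> r \<theta>) w (1, 0) ({0<..<1} \<times> angles)}.
        (\<integral>\<^sup>+r\<in>{0<..<1}. L2_norm_sq (\<lambda>\<theta>. w (r, \<theta>)) * ennreal r \<partial>lebesgue))"

text \<open>The profile of \<open>T\<close> is unique up to null sets, so again the infimum ranges over a single
  value.\<close>

definition F :: "(real \<Rightarrow> real) \<Rightarrow> (real \<Rightarrow> real) \<Rightarrow> complex measure \<Rightarrow> complex measure \<Rightarrow>
    (complex \<Rightarrow> complex) \<Rightarrow> ennreal" where
  "F R1 R2 \<mu> \<nu> T =
     (if T \<in> O1 \<mu> \<nu>
      then (INF \<phi>\<in>{\<phi>. radial_profile T \<phi>}. angular_energy R1 R2 \<phi> + radial_energy \<phi>)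
      else \<infinity>)"

end

theory Submission
  imports Defs
begin

text \<open>Write \<open>\<parallel>\<cdot>\<parallel>\<close> for the norm of \<open>L\<^sup>2(0,\<pi>/2)\<close>. Finite radial energy makes \<open>r \<mapsto> \<phi>(r,\<cdot>)\<close> absolutely
  continuous away from \<open>r = 0\<close>: with \<open>w = \<partial>\<^sub>r\<phi>\<close>,
  \<open>\<parallel>\<phi>(t,\<cdot>) - \<phi>(s,\<cdot>)\<parallel>\<^sup>2 \<le> (t - s)/s \<cdot> \<integral>\<^sub>s\<^sup>t r \<parallel>w(r,\<cdot>)\<parallel>\<^sup>2 dr\<close>. Since the obstacle constraints are convex, the
  parallelogram identity gives \<open>\<parallel>\<phi>(r,\<cdot>) - \<Phi>\<parallel>\<^sup>2 / 2 \<le> \<parallel>\<phi>(r,\<cdot>)\<parallel>\<^sup>2 - K\<close> (\<open>H\<^sup>1\<close> norm on the right), so finite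
  angular energy bounds \<open>\<integral> \<parallel>\<phi>(r,\<cdot>) - \<Phi>\<parallel>\<^sup>2 / r dr\<close>. In the scale-invariant window \<open>(t, 2t)\<close> the
  first estimate makes \<open>\<phi>(r,\<cdot>)\<close> almost constant and the second makes the average of
  \<open>\<parallel>\<phi>(r,\<cdot>) - \<Phi>\<parallel>\<^sup>2\<close> small, whence \<open>\<phi>(t,\<cdot>) \<rightarrow> \<Phi>\<close> as \<open>t \<rightarrow> 0\<close>.\<close>

text \<open>Both energies are needed. Radial energy alone gives no limit at 0: near 0 the profile 2
  + sin(log log(1/r)) has finite radial energy and oscillates. Angular energy alone controls only
  averages against dr/r. Every window (t, 2t) has the same dr/r-mass, so the averages there must
  become small, and the radial energy of the window passes this on to its endpoint t.

  The technical obstacle is that \<open>\<partial>\<^sub>r\<phi>\<close> exists only as a weak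
  derivative on an open rectangle, tested against smooth functions, and need not be integrable near
  r = 0. Hence the primitive used is the tail integral V from r to the right, and a du Bois-Reymond
  argument with \<theta> as parameter shows \<phi> = c(\<theta>) - V(r,\<theta>) almost everywhere.
  This formula is the continuous representative for r > 0.

  The value at 0 is not constructed as a limit: the representative is defined to be \<Phi> there,
  and continuity at 0 is then the estimate on windows.\<close>

subsection \<open>Smooth functions\<close>

definition smooth :: "('a::euclidean_space \<Rightarrow> real) \<Rightarrow> bool" where
  "smooth f \<longleftrightarrow> (\<forall>k. Ck_function k f)"

lemma Ck_function_SucD: "Ck_function (Suc k) f \<Longrightarrow> Ck_function k f"
proof (induction k arbitrary: f)
  case 0
  then show ?case
    by (auto simp: continuous_on_eq_continuous_within intro: differentiable_imp_continuous_within)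
next
  case (Suc k)
  then show ?case
    by (metis Ck_function.simps(2))
qed

lemma Ck_function_deriv:
  assumes "\<And>x. (f has_derivative f' x) (at x)" "\<And>v. Ck_function k (\<lambda>x. f' x v)"
  shows "Ck_function (Suc k) f"
  using assms frechet_derivative_at[OF assms(1)]
  by (auto simp: differentiable_def)

text \<open>Derivatives are unique, so any explicitly exhibited one may serve; the closure proofs
  can then use the usual differentiation rules instead of \<open>frechet_derivative\<close>.\<close>

lemma Ck_function_Suc_iff:
  "Ck_function (Suc k) f \<longleftrightarrow>
    (\<exists>f'. (\<forall>x. (f has_derivative f' x) (at x)) \<and> (\<forall>v. Ck_function k (\<lambda>x. f' x v)))"
  using Ck_function_deriv by (metis Ck_function.simps(2) frechet_derivative_works)

lemma Ck_function_const: "Ck_function k (\<lambda>x. c)"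
proof (induction k arbitrary: c)
  case (Suc k)
  show ?case by (rule Ck_function_deriv[where f'="\<lambda>x v. 0"]) (auto intro: Suc)
qed simp

lemma Ck_function_add: "Ck_function k f \<Longrightarrow> Ck_function k g \<Longrightarrow> Ck_function k (\<lambda>x. f x + g x)"
proof (induction k arbitrary: f g)
  case (Suc k)
  from Suc.prems obtain f' g' where
    "\<And>x. (f has_derivative f' x) (at x)" "\<And>v. Ck_function k (\<lambda>x. f' x v)"
    "\<And>x. (g has_derivative g' x) (at x)" "\<And>v. Ck_function k (\<lambda>x. g' x v)"
    unfolding Ck_function_Suc_iff by blast
  then show ?case
    by (intro Ck_function_deriv[where f'="\<lambda>x v. f' x v + g' x v"] has_derivative_add Suc.IH)
qed (auto intro: continuous_on_add)

lemma Ck_function_mult: "Ck_function k f \<Longrightarrow> Ck_function k g \<Longrightarrow> Ck_function k (\<lambda>x. f x * g x)"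
proof (induction k arbitrary: f g)
  case (Suc k)
  from Suc.prems obtain f' g' where
    *: "\<And>x. (f has_derivative f' x) (at x)" "\<And>v. Ck_function k (\<lambda>x. f' x v)"
    "\<And>x. (g has_derivative g' x) (at x)" "\<And>v. Ck_function k (\<lambda>x. g' x v)"
    unfolding Ck_function_Suc_iff by blast
  \<comment> \<open>The product rule returns the undifferentiated factors, known to be of class
    \<open>Suc k\<close>; they are lowered to class \<open>k\<close> before the induction hypothesis
    applies.\<close>
  show ?case
    by (intro Ck_function_deriv[where f'="\<lambda>x v. f x * g' x v + f' x v * g x"] has_derivative_mult
        * Ck_function_add Suc.IH Suc.prems[THEN Ck_function_SucD])
qed (auto intro: continuous_on_mult)

lemma Ck_function_affine:
  assumes L: "bounded_linear L" and f: "Ck_function k f"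
  shows "Ck_function k (\<lambda>x. f (L x + c))"
  using f
proof (induction k arbitrary: f)
  case 0
  then show ?case
    by (auto intro!: continuous_intros continuous_on_compose2[where f="\<lambda>x. L x + c" and g=f]
        linear_continuous_on[OF L])
next
  case (Suc k)
  then obtain f' where
    *: "\<And>x. (f has_derivative f' x) (at x)" "\<And>v. Ck_function k (\<lambda>x. f' x v)"
    unfolding Ck_function_Suc_iff by blast
  have "((\<lambda>x. f (L x + c)) has_derivative (\<lambda>v. f' (L x + c) (L v))) (at x)" for x
    by (rule has_derivative_compose[OF _ *(1), where f="\<lambda>x. L x + c"])
       (auto intro!: derivative_eq_intros bounded_linear.has_derivative[OF L])
  then show ?case
    by (intro Ck_function_deriv[where f'="\<lambda>x v. f' (L x + c) (L v)"] Suc.IH * )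
qed

lemma Ck_function_exp: "Ck_function k f \<Longrightarrow> Ck_function k (\<lambda>x. exp (f x))"
proof (induction k)
  case (Suc k)
  then obtain f' where
    *: "\<And>x. (f has_derivative f' x) (at x)" "\<And>v. Ck_function k (\<lambda>x. f' x v)"
    unfolding Ck_function_Suc_iff by blast
  have "Ck_function k (\<lambda>x. exp (f x))"
    using Suc Ck_function_SucD by blast
  then show ?case
    by (intro Ck_function_deriv[where f'="\<lambda>x v. exp (f x) * f' x v"] Ck_function_mult *)
       (auto intro!: derivative_eq_intros * )
qed (auto intro: continuous_intros)

lemma Ck_function_real_deriv:
  assumes "\<And>x. (f has_real_derivative f' x) (at x)" "Ck_function k f'"
  shows "Ck_function (Suc k) f"
  using assms
  by (intro Ck_function_deriv[where f'="\<lambda>x v. f' x * v"] Ck_function_mult Ck_function_const)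
     (auto simp: has_field_derivative_def)

lemma smooth_const: "smooth (\<lambda>x. c)"
  and smooth_add: "smooth f \<Longrightarrow> smooth g \<Longrightarrow> smooth (\<lambda>x. f x + g x)"
  and smooth_mult: "smooth f \<Longrightarrow> smooth g \<Longrightarrow> smooth (\<lambda>x. f x * g x)"
  and smooth_exp: "smooth f \<Longrightarrow> smooth (\<lambda>x. exp (f x))"
  and smooth_affine: "bounded_linear L \<Longrightarrow> smooth h \<Longrightarrow> smooth (\<lambda>x. h (L x + c))"
  by (simp_all add: smooth_def Ck_function_const Ck_function_add Ck_function_mult
      Ck_function_exp Ck_function_affine)

lemma smooth_diff: "smooth f \<Longrightarrow> smooth g \<Longrightarrow> smooth (\<lambda>x. f x - g x)"
  using smooth_add[OF _ smooth_mult[OF smooth_const[of "-1"]], of f g] by simp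

lemma smooth_continuous_on: "smooth f \<Longrightarrow> continuous_on S f"
  using continuous_on_subset[of UNIV f S] by (auto simp: smooth_def dest: spec[of _ 0])

text \<open>Makes primitives of smooth functions admissible in tests. Order k is derived from order
  k + 1, which covers k = 0 without a case distinction.\<close>

lemma smooth_real_deriv:
  assumes "\<And>x. (f has_real_derivative f' x) (at x)" "smooth f'"
  shows "smooth f"
  unfolding smooth_def
proof
  fix k
  show "Ck_function k f"
    using assms unfolding smooth_def by (blast intro: Ck_function_SucD Ck_function_real_deriv)
qed

text \<open>The functions \<open>p(1/x) exp(-1/x)\<close> are closed under differentiation.\<close>

definition flat :: "real poly \<Rightarrow> real \<Rightarrow> real" where
  "flat p x = (if 0 < x then poly p (1 / x) * exp (- (1 / x)) else 0)"

lemma poly_times_exp_minus_tendsto_0: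
  "((\<lambda>y. poly p y * exp (- y)) \<longlongrightarrow> (0::real)) at_top"
proof (induction p)
  case 0
  then show ?case by simp
next
  case (pCons a p)
  have "((\<lambda>y. y ^ n / exp y) \<longlongrightarrow> (0::real)) at_top" for n
    by (rule tendsto_power_div_exp_0)
  then have *: "((\<lambda>y. \<Sum>i\<le>degree q. coeff q i * (y ^ i / exp y)) \<longlongrightarrow> (\<Sum>i\<le>degree q. coeff q i * 0)) at_top"
    for q :: "real poly"
    by (intro tendsto_sum tendsto_mult tendsto_const)
  show ?case
    using *[of "pCons a p"] unfolding poly_altdef
    by (simp only: exp_minus sum_distrib_right divide_inverse mult.assoc mult_zero_right sum.neutral_const)
qed

text \<open>With y = 1/x the chain rule turns p(y) exp(-y) into y^2 (p(y) - p'(y)) exp(-y), and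
  \<open>[:0, 0, 1:]\<close> is the polynomial y^2. Only x = 0 needs a limit.\<close>

lemma flat_has_real_derivative:
  "(flat p has_real_derivative flat ([:0, 0, 1:] * (p - pderiv p)) x) (at x)"
proof -
  consider "x > 0" | "x < 0" | "x = 0" by linarith
  then show ?thesis
  proof cases
    case 1
    have "((\<lambda>x. poly p (1 / x) * exp (- (1 / x))) has_real_derivative
        flat ([:0, 0, 1:] * (p - pderiv p)) x) (at x)"
      using 1 by (auto intro!: derivative_eq_intros simp: flat_def field_simps power2_eq_square)
    then show ?thesis
      by (rule has_field_derivative_transform_within_open[where S="{0<..}"])
         (use 1 in \<open>auto simp: flat_def\<close>)
  next
    case 2
    have "((\<lambda>x. 0) has_real_derivative flat ([:0, 0, 1:] * (p - pderiv p)) x) (at x)"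
      using 2 by (auto simp: flat_def)
    then show ?thesis
      by (rule has_field_derivative_transform_within_open[where S="{..<0}"])
         (use 2 in \<open>auto simp: flat_def\<close>)
  next
    case 3
    \<comment> \<open>The right difference quotient at 0 is y p(y) exp(-y) with y = 1/h, and
      \<open>pCons 0 p\<close> is the polynomial y p(y).\<close>
    have "((\<lambda>y. poly (pCons 0 p) y * exp (- y)) \<longlongrightarrow> 0) at_top"
      by (rule poly_times_exp_minus_tendsto_0)
    then have "((\<lambda>x. poly (pCons 0 p) (inverse x) * exp (- inverse x)) \<longlongrightarrow> 0) (at_right 0)"
      using filterlim_compose filterlim_inverse_at_top_right by blast
    then have "((\<lambda>h. (flat p (0 + h) - flat p 0) / h) \<longlongrightarrow> 0) (at_right 0)"
      by (rule tendsto_cong[THEN iffD1, rotated])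
         (auto simp: eventually_at_right_less flat_def field_simps
           intro!: eventually_mono[OF eventually_at_right_less[of 0]])
    moreover have "((\<lambda>h. (flat p (0 + h) - flat p 0) / h) \<longlongrightarrow> 0) (at_left 0)"
      by (rule tendsto_eventually) (auto simp: eventually_at_filter flat_def)
    ultimately have "((\<lambda>h. (flat p (0 + h) - flat p 0) / h) \<longlongrightarrow> 0) (at 0)"
      by (rule filterlim_split_at[rotated])
    then show ?thesis
      using 3 by (simp add: DERIV_def flat_def)
  qed
qed

lemma smooth_flat: "smooth (flat p)"
proof -
  have "Ck_function k (flat p)" for k
  proof (induction k arbitrary: p)
    case 0
    show ?case
      unfolding Ck_function.simps
      by (intro continuous_at_imp_continuous_on ballI DERIV_isCont[OF flat_has_real_derivative])
  next
    case (Suc k)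
    show ?case
      by (rule Ck_function_real_deriv[OF flat_has_real_derivative Suc])
  qed
  then show ?thesis by (simp add: smooth_def)
qed

text \<open>The product of the two flat functions is smooth and positive exactly on (a, b).
  Composing it with 1 - exp(-n s) gives smooth functions that increase to the indicator of (a, b) as
  n grows, so limits of tests yield integrals over rectangles without mollification.\<close>

definition plateau :: "nat \<Rightarrow> real \<Rightarrow> real \<Rightarrow> real \<Rightarrow> real" where
  "plateau n a b x = 1 - exp (- (real n * (flat 1 (x - a) * flat 1 (b - x))))"

lemma smooth_plateau: "smooth (plateau n a b)"
proof -
  have "smooth (\<lambda>x. flat 1 (x + (- a)))"
    by (rule smooth_affine[OF bounded_linear_ident smooth_flat])
  moreover have "smooth (\<lambda>x. flat 1 (- x + b))"
    by (rule smooth_affine[OF bounded_linear_minus[OF bounded_linear_ident] smooth_flat])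
  ultimately have "smooth (\<lambda>x. 1 - exp ((- real n) * (flat 1 (x + (- a)) * flat 1 (- x + b))))"
    by (intro smooth_diff smooth_exp smooth_mult smooth_const)
  then show ?thesis
    by (rule back_subst[where P=smooth]) (auto simp: plateau_def)
qed

lemma plateau_eq_0: "x \<notin> {a<..<b} \<Longrightarrow> plateau n a b x = 0"
  by (auto simp: plateau_def flat_def)

lemma plateau_nonneg: "0 \<le> plateau n a b x"
  and plateau_le_1: "plateau n a b x \<le> 1"
  by (auto simp: plateau_def flat_def)

lemma plateau_tendsto: "(\<lambda>n. plateau n a b x) \<longlonglongrightarrow> indicator {a<..<b} x"
proof (cases "x \<in> {a<..<b}")
  case True
  define c where "c = flat 1 (x - a) * flat 1 (b - x)"
  have "c > 0" using True by (auto simp: c_def flat_def)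
  then have "(\<lambda>n. exp (- c) ^ n) \<longlonglongrightarrow> 0"
    by (intro LIMSEQ_power_zero) auto
  then have "(\<lambda>n. exp (- (real n * c))) \<longlonglongrightarrow> 0"
    by (simp flip: exp_of_nat_mult)
  then have "(\<lambda>n. 1 - exp (- (real n * c))) \<longlonglongrightarrow> 1 - 0"
    by (intro tendsto_diff tendsto_const)
  then show ?thesis using True by (simp add: plateau_def c_def)
qed (simp add: plateau_eq_0)

subsection \<open>Weak differentiability along the first coordinate\<close>

text \<open>Boxes are an intersection-stable generator of the Borel sets, and for integrable f the
  sets over which f integrates to 0 form a Dynkin system. So f integrates to 0 over every Borel
  set.\<close>

lemma AE_zero_if_box_integrals_zero:
  fixes f :: "'a::euclidean_space \<Rightarrow> real"
  assumes f: "integrable lborel f"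
    and box: "\<And>a b. (LINT x:box a b|lborel. f x) = 0"
  shows "AE x in lborel. f x = 0"
proof (rule sigma_finite_measure.density_zero[OF lborel.sigma_finite_measure_axioms f])
  let ?E = "range (\<lambda>(a, b). box a b::'a set)"
  have int: "set_integrable lborel B f" if "B \<in> sets borel" for B
    unfolding set_integrable_def using that f by (intro integrable_mult_indicator) auto
  \<comment> \<open>The whole space is not a box but an increasing union of boxes; its integral is
    needed for complements.\<close>
  have "(\<lambda>n. LINT x:box (- (real n *\<^sub>R One)) (real n *\<^sub>R One)|lborel. f x) \<longlonglongrightarrow>
      (LINT x:(\<Union>n. box (- (real n *\<^sub>R One)) (real n *\<^sub>R One))|lborel. f x)"
  proof (intro set_integral_cont_up int)
    show "incseq (\<lambda>n. box (- (real n *\<^sub>R One)) (real n *\<^sub>R One :: 'a))"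
      by (intro incseq_SucI subset_box_imp) (auto simp: inner_add_left)
  qed auto
  then have univ: "(LINT x:UNIV|lborel. f x) = 0"
    unfolding UN_box_eq_UNIV using box by (simp add: LIMSEQ_const_iff)
  fix B :: "'a set" assume "B \<in> sets lborel"
  then have "B \<in> sigma_sets UNIV ?E"
    by (simp add: borel_eq_box)
  have "Int_stable ?E"
    by (auto simp: Int_stable_def box_Int_box)
  then show "(LINT x:B|lborel. f x) = 0"
    using subset_UNIV[of ?E, folded Pow_UNIV] \<open>B \<in> sigma_sets UNIV ?E\<close>
  proof (induction rule: sigma_sets_induct_disjoint)
    case (compl B)
    then have B: "B \<in> sets borel" by (simp add: borel_eq_box)
    have "(LINT x:B \<union> (UNIV - B)|lborel. f x) = (LINT x:B|lborel. f x) + (LINT x:UNIV - B|lborel. f x)"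
      using B by (intro set_integral_Un int) auto
    then show ?case using univ compl by simp
  next
    case (union A)
    then have "A i \<in> sets borel" for i by (auto simp: borel_eq_box)
    then have "(LINT x:(\<Union>i. A i)|lborel. f x) = (\<Sum>i. (LINT x:A i|lborel. f x))"
      using union by (intro lebesgue_integral_countable_add int) (auto simp: disjoint_family_on_def)
    then show ?case using union by simp
  qed (use box in \<open>auto simp: set_lebesgue_integral_def\<close>)
qed

lemma borel_measurable_fst_comp:
  fixes f :: "real \<Rightarrow> real"
  assumes "f \<in> borel_measurable borel"
  shows "(\<lambda>p::real \<times> real. f (fst p)) \<in> borel_measurable borel"
  using borel_measurable_continuous_onI[OF continuous_on_fst[OF continuous_on_id]] assms
  by (rule measurable_compose)

lemma borel_measurable_snd_comp:
  fixes f :: "real \<Rightarrow> real"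
  assumes "f \<in> borel_measurable borel"
  shows "(\<lambda>p::real \<times> real. f (snd p)) \<in> borel_measurable borel"
  using borel_measurable_continuous_onI[OF continuous_on_snd[OF continuous_on_id]] assms
  by (rule measurable_compose)

lemma test_function_product:
  fixes \<alpha> \<beta> :: "real \<Rightarrow> real"
  assumes "smooth \<alpha>" "smooth \<beta>" "\<And>x. x \<notin> {a..b} \<Longrightarrow> \<alpha> x = 0" "\<And>x. x \<notin> {c..d} \<Longrightarrow> \<beta> x = 0"
    "{a..b} \<times> {c..d} \<subseteq> U"
  shows "test_function U (\<lambda>p. \<alpha> (fst p) * \<beta> (snd p))"
proof -
  have "smooth (\<lambda>p::real \<times> real. \<alpha> (fst p + 0) * \<beta> (snd p + 0))"
    by (rule smooth_mult[OF smooth_affine[OF bounded_linear_fst assms(1)]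
          smooth_affine[OF bounded_linear_snd assms(2)]])
  moreover have "{p. \<alpha> (fst p) * \<beta> (snd p) \<noteq> 0} \<subseteq> {a..b} \<times> {c..d}"
  proof
    fix p assume "p \<in> {p. \<alpha> (fst p) * \<beta> (snd p) \<noteq> 0}"
    then have "\<alpha> (fst p) \<noteq> 0" "\<beta> (snd p) \<noteq> 0" by auto
    then show "p \<in> {a..b} \<times> {c..d}"
      unfolding mem_Times_iff using assms(3,4) by blast
  qed
  then have *: "closure {p. \<alpha> (fst p) * \<beta> (snd p) \<noteq> 0} \<subseteq> {a..b} \<times> {c..d}"
    by (intro closure_minimal closed_Times closed_atLeastAtMost)
  moreover have "compact (closure {p. \<alpha> (fst p) * \<beta> (snd p) \<noteq> 0})"
    by (rule compact_closure[THEN iffD2, OF bounded_subset[OF _ *[THEN order_trans[OF closure_subset]]]])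
       (intro bounded_Times bounded_closed_interval)
  ultimately show ?thesis
    using order_trans[OF * assms(5)] by (simp add: test_function_def smooth_def)
qed

lemma frechet_derivative_product_fst:
  fixes \<alpha> \<beta> :: "real \<Rightarrow> real" and p :: "real \<times> real"
  assumes "(\<alpha> has_real_derivative \<alpha>') (at (fst p))" "smooth \<beta>"
  shows "frechet_derivative (\<lambda>p. \<alpha> (fst p) * \<beta> (snd p)) (at p) (1, 0) = \<alpha>' * \<beta> (snd p)"
proof -
  have "\<beta> differentiable (at (snd p))"
    using assms(2) by (auto simp: smooth_def dest: spec[of _ "Suc 0"])
  then obtain \<beta>' where "(\<beta> has_real_derivative \<beta>') (at (snd p))"
    using real_differentiable_def by blast
  then have "((\<lambda>p. \<alpha> (fst p) * \<beta> (snd p)) has_derivative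
      (\<lambda>v. \<alpha> (fst p) * (\<beta>' * snd v) + \<alpha>' * fst v * \<beta> (snd p))) (at p)"
    using assms(1) unfolding has_field_derivative_def
    by (intro has_derivative_mult has_derivative_compose[of fst fst _ _ \<alpha>, OF has_derivative_fst[OF has_derivative_ident]]
        has_derivative_compose[of snd snd _ _ \<beta>, OF has_derivative_snd[OF has_derivative_ident]])
  from fun_cong[OF frechet_derivative_at[OF this], of "(1, 0)"] show ?thesis
    by simp
qed

section \<open>Tail integrals and integration by parts\<close>

lemma (in pair_sigma_finite) integrable_mult_pair:
  fixes f :: "'a \<Rightarrow> real" and g :: "'b \<Rightarrow> real"
  assumes f: "integrable M1 f" and g: "integrable M2 g"
  shows "integrable (M1 \<Otimes>\<^sub>M M2) (\<lambda>(x, y). f x * g y)"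
proof (rule Fubini_integrable)
  have [measurable]: "f \<in> borel_measurable M1" "g \<in> borel_measurable M2"
    using f g by auto
  show "(\<lambda>(x, y). f x * g y) \<in> borel_measurable (M1 \<Otimes>\<^sub>M M2)"
    by measurable
  show "integrable M1 (\<lambda>x. LINT y|M2. norm (case (x, y) of (x, y) \<Rightarrow> f x * g y))"
    using f by (simp add: abs_mult)
qed (use g in simp)

text \<open>Fubini on the region r < s: for fixed s the inner integral of A over r < s is
  \<alpha>(s). The cut-off \<delta> allows h to be non-integrable near 0, since A and \<alpha>
  vanish below it.\<close>

lemma integral_tail_by_parts:
  fixes h \<alpha> A :: "real \<Rightarrow> real"
  assumes h: "integrable lborel (\<lambda>s. indicator {\<delta><..} s * h s)"
    and \<alpha>: "\<And>x. (\<alpha> has_real_derivative A x) (at x)" and A: "continuous_on UNIV A"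
    and A0: "\<And>x. x \<notin> {\<delta>..M} \<Longrightarrow> A x = 0" and \<alpha>0: "\<And>x. x \<le> \<delta> \<Longrightarrow> \<alpha> x = 0"
  shows "(LINT r|lborel. (LINT s|lborel. (if r < s then h s else 0)) * A r) = (LINT s|lborel. h s * \<alpha> s)"
proof -
  let ?h = "\<lambda>s. indicator {\<delta><..} s * h s"
  let ?g = "\<lambda>r s. if r < s then ?h s * A r else 0"
  have isCont: "isCont A x" for x
    using A by (simp add: continuous_on_eq_continuous_at)
  have [measurable]: "A \<in> borel_measurable borel"
    by (rule borel_measurable_continuous_onI[OF A])
  have [measurable]: "?h \<in> borel_measurable borel"
    using h by auto
  have "set_integrable lborel {\<delta>..M} A"
    using continuous_on_subset[OF A] by (intro borel_integrable_atLeastAtMost') auto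
  moreover have "indicator {\<delta>..M} x *\<^sub>R A x = A x" for x
    using A0[of x] by (cases "x \<in> {\<delta>..M}") auto
  ultimately have "integrable lborel A"
    by (simp only: set_integrable_def)
  then have "integrable (lborel \<Otimes>\<^sub>M lborel) (\<lambda>(r, s). A r * ?h s)"
    using h by (rule lborel_pair.integrable_mult_pair)
  then have "integrable (lborel \<Otimes>\<^sub>M lborel) (\<lambda>(r, s). ?g r s)"
  proof (rule Bochner_Integration.integrable_bound)
    show "(\<lambda>(r, s). ?g r s) \<in> borel_measurable (lborel \<Otimes>\<^sub>M lborel)"
      by measurable
    show "AE p in lborel \<Otimes>\<^sub>M lborel. norm (case p of (r, s) \<Rightarrow> ?g r s) \<le> norm (case p of (r, s) \<Rightarrow> A r * ?h s)"
      by (intro AE_I2) (simp add: case_prod_beta' abs_mult mult.commute)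
  qed
  then have "(LINT s|lborel. (LINT r|lborel. ?g r s)) = (LINT r|lborel. (LINT s|lborel. ?g r s))"
    by (rule lborel_pair.Fubini_integral)
  moreover have "(LINT s|lborel. ?g r s) = (LINT s|lborel. (if r < s then h s else 0)) * A r" for r
  proof (cases "r < \<delta>")
    case True
    \<comment> \<open>Here h need not be integrable beyond r, so its tail integral may be the
      default value 0; the factor A(r) = 0 makes both sides agree in any case.\<close>
    then have "A r = 0" by (auto intro: A0)
    then show ?thesis by (simp cong: if_cong)
  next
    case False
    have "(LINT s|lborel. ?g r s) = (LINT s|lborel. (if r < s then h s else 0) * A r)"
      using False by (intro Bochner_Integration.integral_cong) (simp_all add: indicator_def)
    then show ?thesis by simp
  qed
  moreover have "(LINT r|lborel. ?g r s) = h s * \<alpha> s" for s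
  proof (cases "\<delta> < s")
    case True
    have "(LINT r|lborel. ?g r s) = (LINT r|lborel. h s * (A r * indicator {\<delta>..s} r))"
    proof (intro integral_cong_AE)
      \<comment> \<open>The region r < s and the closed interval required by the fundamental theorem
        differ in the single point r = s.\<close>
      show "AE r in lborel. ?g r s = h s * (A r * indicator {\<delta>..s} r)"
        using AE_lborel_singleton[of s]
      proof eventually_elim
        case (elim r)
        show ?case
          using True A0[of r] elim by (cases "r < \<delta>") (auto simp: indicator_def)
      qed
    qed measurable
    also have "\<dots> = h s * (\<alpha> s - \<alpha> \<delta>)"
      using True integral_FTC_Icc_real[of \<delta> s \<alpha> A] \<alpha> isCont by simp
    finally show ?thesis by (simp add: \<alpha>0)
  next
    case False
    then show ?thesis by (simp add: \<alpha>0 cong: if_cong)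
  qed
  ultimately show ?thesis by simp
qed

text \<open>For r > a the tail is bounded by the integral of |z| over the fibre beyond a. That bound
  does not depend on r, so integrating it over a strip of finite width costs only the factor b -
  a.\<close>

lemma integrable_tail_on_strip:
  fixes z :: "real \<times> real \<Rightarrow> real"
  defines "V \<equiv> \<lambda>p. LINT s|lborel. (if fst p < s then z (s, snd p) else 0)"
  assumes [measurable]: "z \<in> borel_measurable borel"
    and z: "integrable lborel (\<lambda>p. indicator {a<..} (fst p) * z p)"
  shows "integrable lborel (\<lambda>p. indicator {a<..<b} (fst p) * V p)"
proof -
  note borel_prod[symmetric, measurable_cong]
  have [measurable]: "z \<in> borel_measurable (borel \<Otimes>\<^sub>M borel)"
    by (simp add: borel_prod)
  have V[measurable]: "V \<in> borel_measurable borel"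
    unfolding V_def borel_prod[symmetric] by measurable
  show ?thesis
  proof (rule integrableI_bounded)
    have "(\<integral>\<^sup>+p. ennreal (norm (indicator {a<..<b} (fst p) * V p)) \<partial>lborel) \<le>
        (\<integral>\<^sup>+p. indicator {a<..<b} (fst p) * (\<integral>\<^sup>+s. ennreal (norm (indicator {a<..} s * z (s, snd p))) \<partial>lborel) \<partial>lborel)"
    proof (intro nn_integral_mono)
      fix p :: "real \<times> real"
      \<comment> \<open>On fibres where z is not integrable the Bochner integral is 0 by default,
        and the bound still holds.\<close>
      have "ennreal (norm (LINT s|lborel. (if fst p < s then z (s, snd p) else 0))) \<le>
          (\<integral>\<^sup>+s. ennreal (norm (if fst p < s then z (s, snd p) else 0)) \<partial>lborel)"
      proof (cases "integrable lborel (\<lambda>s. if fst p < s then z (s, snd p) else 0)")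
        case True
        then show ?thesis by (rule integral_norm_bound_ennreal)
      qed (simp add: not_integrable_integral_eq)
      also have "\<dots> \<le> (\<integral>\<^sup>+s. ennreal (norm (indicator {a<..} s * z (s, snd p))) \<partial>lborel)" if "a < fst p"
        using that by (intro nn_integral_mono) auto
      finally show "ennreal (norm (indicator {a<..<b} (fst p) * V p)) \<le>
          indicator {a<..<b} (fst p) * (\<integral>\<^sup>+s. ennreal (norm (indicator {a<..} s * z (s, snd p))) \<partial>lborel)"
        by (auto simp: V_def indicator_def)
    qed
    also have "\<dots> = (\<integral>\<^sup>+\<theta>. \<integral>\<^sup>+r. indicator {a<..<b} r *
        (\<integral>\<^sup>+s. ennreal (norm (indicator {a<..} s * z (s, \<theta>))) \<partial>lborel) \<partial>lborel \<partial>lborel)"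
      unfolding lborel_prod[symmetric] by (subst lborel_pair.nn_integral_snd[symmetric]) auto
    also have "\<dots> = (\<integral>\<^sup>+\<theta>. emeasure lborel {a<..<b} *
        (\<integral>\<^sup>+s. ennreal (norm (indicator {a<..} s * z (s, \<theta>))) \<partial>lborel) \<partial>lborel)"
      by (subst nn_integral_multc) auto
    also have "\<dots> = emeasure lborel {a<..<b} *
        (\<integral>\<^sup>+p. ennreal (norm (indicator {a<..} (fst p) * z p)) \<partial>lborel)"
      unfolding lborel_prod[symmetric]
      by (subst lborel_pair.nn_integral_snd[symmetric]) (auto simp: nn_integral_cmult)
    also have "\<dots> < \<infinity>"
    proof -
      have "emeasure lborel {a<..<b} < \<infinity>"
        by (cases "a \<le> b") auto
      then show ?thesis
        using z by (auto simp: ennreal_mult_less_top integrable_iff_bounded)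
    qed
    finally show "(\<integral>\<^sup>+p. ennreal (norm (indicator {a<..<b} (fst p) * V p)) \<partial>lborel) < \<infinity>" .
  next
    show "(\<lambda>p. indicator {a<..<b} (fst p) * V p) \<in> borel_measurable lborel"
      using V by (intro borel_measurable_times) (auto intro!: borel_measurable_fst_comp)
  qed
qed

text \<open>V is an integral from r to the right, so its radial derivative is -z. The sum v + V
  therefore has weak radial derivative 0, expressed here through product tests.\<close>

lemma weak_derivative_fst_tested:
  fixes v z :: "real \<times> real \<Rightarrow> real"
  defines "V \<equiv> \<lambda>p. LINT s|lborel. (if fst p < s then z (s, snd p) else 0)"
  assumes [measurable]: "z \<in> borel_measurable borel"
    and v: "integrable lborel v"
    and z: "integrable lborel (\<lambda>p. indicator {a<..} (fst p) * z p)"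
    and weak: "(LINT p|lborel. v p * (A (fst p) * \<beta> (snd p))) = - (LINT p|lborel. z p * (\<alpha> (fst p) * \<beta> (snd p)))"
    and \<alpha>: "\<And>x. (\<alpha> has_real_derivative A x) (at x)" "\<And>x. x \<notin> {a<..<b} \<Longrightarrow> \<alpha> x = 0"
    and A: "continuous_on UNIV A" "\<And>x. x \<notin> {a<..<b} \<Longrightarrow> A x = 0"
    and \<beta>: "continuous_on UNIV \<beta>" "\<And>x. \<bar>\<beta> x\<bar> \<le> 1"
  shows "(LINT p|lborel. (v p + V p) * (A (fst p) * \<beta> (snd p))) = 0"
proof -
  note borel_prod[symmetric, measurable_cong]
  have [measurable]: "z \<in> borel_measurable (borel \<Otimes>\<^sub>M borel)"
    by (simp add: borel_prod)
  have V[measurable]: "V \<in> borel_measurable borel"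
    unfolding V_def borel_prod[symmetric] by measurable
  have [measurable]: "A \<in> borel_measurable borel" "\<beta> \<in> borel_measurable borel" "\<alpha> \<in> borel_measurable borel"
    using A(1) \<beta>(1) DERIV_isCont[OF \<alpha>(1)]
    by (auto intro!: borel_measurable_continuous_onI continuous_at_imp_continuous_on)
  have [measurable]: "v \<in> borel_measurable borel"
    using v by auto
  have int_V: "integrable lborel (\<lambda>p. indicator {a<..<b} (fst p) * V p)"
    unfolding V_def by (rule integrable_tail_on_strip[OF assms(2) z])
  obtain K where K: "\<And>x. \<bar>A x\<bar> \<le> K"
  proof -
    have "bounded (A ` {a..b})"
      by (intro compact_imp_bounded compact_continuous_image continuous_on_subset[OF A(1)]) auto
    then obtain K where "\<forall>x\<in>{a..b}. \<bar>A x\<bar> \<le> K" unfolding bounded_iff by auto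
    then have "\<bar>A x\<bar> \<le> max K 0" for x
      using A(2)[of x] by (cases "x \<in> {a..b}") (auto simp: le_max_iff_disj)
    then show ?thesis by (rule that)
  qed
  obtain L where L: "\<And>x. \<bar>\<alpha> x\<bar> \<le> L"
  proof -
    have "bounded (\<alpha> ` {a..b})"
      using DERIV_isCont[OF \<alpha>(1)]
      by (intro compact_imp_bounded compact_continuous_image continuous_at_imp_continuous_on) auto
    then obtain K where "\<forall>x\<in>{a..b}. \<bar>\<alpha> x\<bar> \<le> K" unfolding bounded_iff by auto
    then have "\<bar>\<alpha> x\<bar> \<le> max K 0" for x
      using \<alpha>(2)[of x] by (cases "x \<in> {a..b}") (auto simp: le_max_iff_disj)
    then show ?thesis by (rule that)
  qed
  have "\<bar>A x * \<beta> y\<bar> \<le> \<bar>K\<bar> * 1" for x y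
    unfolding abs_mult using order_trans[OF K[of x] abs_ge_self] \<beta>(2)[of y] by (intro mult_mono) auto
  then have KB: "\<bar>A x * \<beta> y\<bar> \<le> \<bar>K\<bar>" for x y by simp
  have "\<bar>\<alpha> x * \<beta> y\<bar> \<le> \<bar>L\<bar> * 1" for x y
    unfolding abs_mult using order_trans[OF L[of x] abs_ge_self] \<beta>(2)[of y] by (intro mult_mono) auto
  then have LB: "\<bar>\<alpha> x * \<beta> y\<bar> \<le> \<bar>L\<bar>" for x y by simp
  have int_v: "integrable lborel (\<lambda>p. v p * (A (fst p) * \<beta> (snd p)))"
  proof (rule Bochner_Integration.integrable_bound)
    show "integrable lborel (\<lambda>p. v p * K)" using v by simp
    show "AE p in lborel. norm (v p * (A (fst p) * \<beta> (snd p))) \<le> norm (v p * K)"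
    proof (intro AE_I2)
      fix p :: "real \<times> real"
      show "norm (v p * (A (fst p) * \<beta> (snd p))) \<le> norm (v p * K)"
        using mult_left_mono[OF KB, of "\<bar>v p\<bar>"] by (simp add: abs_mult)
    qed
  qed (auto intro!: borel_measurable_times borel_measurable_fst_comp borel_measurable_snd_comp)
  have int_VA: "integrable lborel (\<lambda>p. V p * (A (fst p) * \<beta> (snd p)))"
  proof (rule Bochner_Integration.integrable_bound)
    show "integrable lborel (\<lambda>p. (indicator {a<..<b} (fst p) * V p) * K)" using int_V by simp
    show "AE p in lborel. norm (V p * (A (fst p) * \<beta> (snd p))) \<le> norm ((indicator {a<..<b} (fst p) * V p) * K)"
    proof (intro AE_I2)
      fix p :: "real \<times> real"
      show "norm (V p * (A (fst p) * \<beta> (snd p))) \<le> norm ((indicator {a<..<b} (fst p) * V p) * K)"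
      proof (cases "fst p \<in> {a<..<b}")
        case True
        then show ?thesis
          using mult_left_mono[OF KB, of "\<bar>V p\<bar>"] by (simp add: abs_mult)
      qed (simp add: A(2))
    qed
  qed (auto intro!: borel_measurable_times borel_measurable_fst_comp borel_measurable_snd_comp)
  have int_z: "integrable lborel (\<lambda>p. z p * (\<alpha> (fst p) * \<beta> (snd p)))"
  proof (rule Bochner_Integration.integrable_bound)
    show "integrable lborel (\<lambda>p. (indicator {a<..} (fst p) * z p) * L)" using z by simp
    show "AE p in lborel. norm (z p * (\<alpha> (fst p) * \<beta> (snd p))) \<le> norm ((indicator {a<..} (fst p) * z p) * L)"
    proof (intro AE_I2)
      fix p :: "real \<times> real"
      show "norm (z p * (\<alpha> (fst p) * \<beta> (snd p))) \<le> norm ((indicator {a<..} (fst p) * z p) * L)"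
      proof (cases "fst p \<in> {a<..<b}")
        case True
        then show ?thesis
          using mult_left_mono[OF LB, of "\<bar>z p\<bar>"] by (simp add: abs_mult)
      qed (simp add: \<alpha>(2))
    qed
  qed (auto intro!: borel_measurable_times borel_measurable_fst_comp borel_measurable_snd_comp)
  \<comment> \<open>Integration by parts is done on single fibres, and almost every fibre inherits
    integrability beyond a.\<close>
  have "AE \<theta> in lborel. integrable lborel (\<lambda>s. indicator {a<..} s * z (s, \<theta>))"
    using z unfolding lborel_prod[symmetric]
    by (intro lborel_pair.AE_integrable_snd) (simp add: case_prod_beta')
  then have "AE \<theta> in lborel. (LINT r|lborel. V (r, \<theta>) * A r) = (LINT s|lborel. z (s, \<theta>) * \<alpha> s)"
  proof eventually_elim
    case (elim \<theta>)
    then show ?case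
      unfolding V_def fst_conv snd_conv
      by (rule integral_tail_by_parts[where M=b]) (use \<alpha> A in auto)
  qed
  then have ae: "AE \<theta> in lborel. (LINT r|lborel. V (r, \<theta>) * (A r * \<beta> \<theta>)) = (LINT s|lborel. z (s, \<theta>) * (\<alpha> s * \<beta> \<theta>))"
    by eventually_elim (simp flip: mult.assoc)
  have "(LINT p|lborel. V p * (A (fst p) * \<beta> (snd p))) = (LINT \<theta>|lborel. LINT r|lborel. V (r, \<theta>) * (A r * \<beta> \<theta>))"
    using int_VA unfolding lborel_prod[symmetric]
    by (subst lborel_pair.integral_snd) (simp_all add: case_prod_beta')
  also have "\<dots> = (LINT \<theta>|lborel. LINT s|lborel. z (s, \<theta>) * (\<alpha> s * \<beta> \<theta>))"
    by (intro integral_cong_AE ae) measurable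
  also have "\<dots> = (LINT p|lborel. z p * (\<alpha> (fst p) * \<beta> (snd p)))"
    using int_z unfolding lborel_prod[symmetric]
    by (subst lborel_pair.integral_snd) (simp_all add: case_prod_beta')
  finally show "(LINT p|lborel. (v p + V p) * (A (fst p) * \<beta> (snd p))) = 0"
    using weak int_v int_VA by (simp add: distrib_right)
qed

text \<open>Mean zero is exactly what makes the primitive return to 0 at b and stay there.\<close>

lemma compactly_supported_primitive:
  fixes A :: "real \<Rightarrow> real"
  assumes A: "continuous_on UNIV A" "\<And>x. x \<notin> {a<..<b} \<Longrightarrow> A x = 0" and "(LINT x|lborel. A x) = 0"
  obtains \<alpha> where "\<And>x. (\<alpha> has_real_derivative A x) (at x)" "\<And>x. x \<notin> {a<..<b} \<Longrightarrow> \<alpha> x = 0"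
proof -
  \<comment> \<open>Starting at a - 1 instead of a makes x = a an interior point of the interval of
    integration, so the derivative there is two-sided.\<close>
  define \<alpha> where "\<alpha> x = integral {a - 1..x} A" for x
  have le: "\<alpha> x = 0" if "x \<le> a" for x
  proof -
    have "\<alpha> x = integral {a - 1..x} (\<lambda>_. 0)"
      unfolding \<alpha>_def using that A(2) by (intro integral_cong) auto
    then show ?thesis by simp
  qed
  have ge: "\<alpha> x = 0" if "b \<le> x" for x
  proof -
    have "set_integrable lborel {a..b} A"
      using continuous_on_subset[OF A(1)] by (intro borel_integrable_atLeastAtMost') auto
    moreover have "indicator {a..b} x *\<^sub>R A x = A x" for x
      using A(2)[of x] by (cases "x \<in> {a..b}") auto
    ultimately have int: "integrable lborel A"
      by (simp only: set_integrable_def)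
    have "\<alpha> x = integral UNIV (\<lambda>t. if t \<in> {a - 1..x} then A t else 0)"
      unfolding \<alpha>_def by (simp only: integral_restrict_UNIV)
    also have "\<dots> = integral UNIV A"
      using that A(2) by (intro integral_cong) force
    also have "\<dots> = 0"
      using assms(3) int by (simp add: integral_lborel)
    finally show ?thesis .
  qed
  have "(\<alpha> has_real_derivative A x) (at x)" for x
  proof (cases "x < a")
    case True
    have "((\<lambda>_. 0) has_real_derivative A x) (at x)"
      using True A(2)[of x] by auto
    then show ?thesis
      by (rule has_field_derivative_transform_within_open[where S="{..<a}"])
         (use True le in auto)
  next
    case False
    then have "(\<alpha> has_real_derivative A x) (at x within {a - 1..x + 1})"
      unfolding \<alpha>_def[abs_def]
      by (intro integral_has_real_derivative continuous_on_subset[OF A(1)]) auto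
    moreover have "at x within {a - 1..x + 1} = at x"
      using False by (intro at_within_interior) (auto simp: interior_atLeastAtMost_real)
    ultimately show ?thesis by simp
  qed
  then show ?thesis
    using le ge by (intro that[of \<alpha>]) force+
qed

lemma box_real_prod: "box a b = {fst a<..<fst b} \<times> {snd a<..<snd b}" for a b :: "real \<times> real"
  by (auto simp: mem_box Basis_prod_def inner_prod_def)

text \<open>A du Bois-Reymond lemma with a parameter. The function D = v + V has weak radial
  derivative 0, so its averages over rectangles do not depend on the r-interval; hence D is a
  function of \<theta> alone.\<close>

lemma weak_derivative_fst_imp_primitive:
  fixes v z :: "real \<times> real \<Rightarrow> real"
  defines "V \<equiv> \<lambda>p. LINT s|lborel. (if fst p < s then z (s, snd p) else 0)"
  assumes z_meas[measurable]: "z \<in> borel_measurable borel"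
    and v: "integrable lborel v"
    and z: "\<And>\<delta>. \<delta> > 0 \<Longrightarrow> integrable lborel (\<lambda>p. indicator {\<delta><..} (fst p) * z p)"
    and weak: "\<And>\<psi>. test_function ({0<..<1} \<times> {l<..<u}) \<psi> \<Longrightarrow>
      (LINT p|lborel. v p * frechet_derivative \<psi> (at p) (1, 0)) = - (LINT p|lborel. z p * \<psi> p)"
  shows "\<exists>c\<in>borel_measurable borel. AE p in lborel. p \<in> {0<..<1} \<times> {l<..<u} \<longrightarrow> v p = c (snd p) - V p"
proof -
  note borel_prod[symmetric, measurable_cong]
  have [measurable]: "z \<in> borel_measurable (borel \<Otimes>\<^sub>M borel)"
    by (simp add: borel_prod)
  have V[measurable]: "V \<in> borel_measurable borel"
    unfolding V_def borel_prod[symmetric] by measurable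
  have [measurable]: "v \<in> borel_measurable borel"
    using v by auto
  define D where "D p = v p + V p" for p
  have [measurable]: "D \<in> borel_measurable borel"
    unfolding D_def by measurable
  have int_D: "integrable lborel (\<lambda>p. indicator {a<..<b} (fst p) * D p)" if "0 < a" for a b
  proof -
    have "integrable lborel (\<lambda>p. indicator {a<..<b} (fst p) * V p)"
      unfolding V_def by (rule integrable_tail_on_strip[OF z_meas z[OF that]])
    moreover have "integrable lborel (\<lambda>p. indicator {a<..<b} (fst p) * v p)"
      using integrable_mult_indicator[OF _ v, of "{a<..<b} \<times> UNIV"]
      by (simp add: indicator_times borel_Times)
    ultimately show ?thesis
      by (simp add: D_def distrib_left)
  qed
  have rect_D: "integrable lborel (\<lambda>p. indicator {a<..<b} (fst p) * indicator J (snd p) * D p)"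
    if "0 < a" "J \<in> sets borel" for a b J
  proof -
    have "UNIV \<times> J \<in> sets (borel :: (real \<times> real) measure)"
      using that(2) by (intro borel_Times) auto
    then have "integrable lborel (\<lambda>p. indicator (UNIV \<times> J) p *\<^sub>R (indicator {a<..<b} (fst p) * D p))"
      using int_D[OF that(1)] by (intro integrable_mult_indicator) auto
    then show ?thesis
      by (simp add: indicator_times mult_ac)
  qed
  define I where "I a b c d = (LINT p|lborel. indicator {a<..<b} (fst p) * indicator {c<..<d} (snd p) * D p)"
    for a b c d
  \<comment> \<open>A combination of two plateaus with mean zero is the derivative of an admissible \<open>\<alpha>\<close>;
    testing with it compares the averages of \<open>D\<close> over two intervals of \<open>r\<close>.\<close>
  have I_eq: "(b' - a') * I a b c d = (b - a) * I a' b' c d"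
    if ab: "0 < a" "a < b" "b < 1" "0 < a'" "a' < b'" "b' < 1" "l < c" "d < u"
    for a b a' b' c d
  proof -
    define a0 b0 where "a0 = min a a'" and "b0 = max b b'"
    define m m' where "m n = (LINT x|lborel. plateau n a b x)" and "m' n = (LINT x|lborel. plateau n a' b' x)" for n
    define G where "G n a b = (LINT p|lborel. D p * (plateau n a b (fst p) * plateau n c d (snd p)))" for n a b
    have [measurable]: "plateau n a b \<in> borel_measurable borel" for n a b
      by (intro borel_measurable_continuous_onI smooth_continuous_on smooth_plateau)
    have abs_plateau: "\<bar>plateau n a b x\<bar> \<le> indicator {a<..<b} x" for n a b x
      using plateau_nonneg[of n a b x] plateau_le_1[of n a b x] plateau_eq_0[of x a b n]
      by (cases "x \<in> {a<..<b}") auto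
    have int_ind: "integrable lborel (indicator {a<..<b} :: real \<Rightarrow> real)" for a b :: real
      by (cases "a \<le> b") auto
    have int_plateau: "integrable lborel (plateau n a b)" for n a b
      by (rule Bochner_Integration.integrable_bound[OF int_ind[of a b]]) (use abs_plateau in auto)
    have lim_m: "(\<lambda>n. LINT x|lborel. plateau n a b x) \<longlonglongrightarrow> b - a" if "a < b" for a b
    proof -
      have "(\<lambda>n. LINT x|lborel. plateau n a b x) \<longlonglongrightarrow> (LINT x|lborel. indicator {a<..<b} x)"
        by (rule integral_dominated_convergence[where w="indicator {a<..<b}"])
           (use int_ind abs_plateau plateau_tendsto in auto)
      then show ?thesis using that by simp
    qed
    have bound_G: "\<bar>D p * (plateau n a b (fst p) * plateau n c d (snd p))\<bar> \<le> \<bar>indicator {a<..<b} (fst p) * D p\<bar>"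
      for n a b p
    proof -
      have "\<bar>plateau n a b (fst p)\<bar> * \<bar>plateau n c d (snd p)\<bar> \<le> indicator {a<..<b} (fst p) * 1"
        using abs_plateau plateau_nonneg plateau_le_1 by (intro mult_mono) auto
      then have "\<bar>D p\<bar> * (\<bar>plateau n a b (fst p)\<bar> * \<bar>plateau n c d (snd p)\<bar>) \<le> \<bar>D p\<bar> * (indicator {a<..<b} (fst p) * 1)"
        by (rule mult_left_mono) simp
      then show ?thesis by (simp add: abs_mult mult.commute)
    qed
    have meas_G: "(\<lambda>p. D p * (plateau n a b (fst p) * plateau n c d (snd p))) \<in> borel_measurable borel" for n a b
      by (auto intro!: borel_measurable_times borel_measurable_fst_comp borel_measurable_snd_comp)
    have int_G: "integrable lborel (\<lambda>p. D p * (plateau n a b (fst p) * plateau n c d (snd p)))" if "0 < a" for n a b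
      by (rule Bochner_Integration.integrable_bound[OF int_D[OF that, of b]]) (use bound_G meas_G in auto)
    have lim_G: "(\<lambda>n. G n a b) \<longlonglongrightarrow> I a b c d" if "0 < a" for a b
      unfolding G_def I_def
    proof (rule integral_dominated_convergence[where w="\<lambda>p. \<bar>indicator {a<..<b} (fst p) * D p\<bar>"])
      show "AE p in lborel. (\<lambda>n. D p * (plateau n a b (fst p) * plateau n c d (snd p)))
          \<longlonglongrightarrow> indicator {a<..<b} (fst p) * indicator {c<..<d} (snd p) * D p"
        using tendsto_mult[OF tendsto_const tendsto_mult[OF plateau_tendsto plateau_tendsto]]
        by (intro AE_I2) (simp add: mult_ac)
      show "(\<lambda>p. indicator {a<..<b} (fst p) * indicator {c<..<d} (snd p) * D p) \<in> borel_measurable lborel"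
        using rect_D[OF that, of "{c<..<d}" b] by auto
    qed (use int_D[OF that] bound_G meas_G in auto)
    have "m' n * G n a b = m n * G n a' b'" for n
    proof -
      \<comment> \<open>Each plateau is weighted by the integral of the other one. As n grows the
        weights tend to the lengths of the two intervals.\<close>
      define A where "A x = m' n * plateau n a b x - m n * plateau n a' b' x" for x
      have smooth_A: "smooth A"
        unfolding A_def[abs_def] by (intro smooth_diff smooth_mult smooth_const smooth_plateau)
      have A0: "A x = 0" if "x \<notin> {a0<..<b0}" for x
      proof -
        have "x \<notin> {a<..<b}" "x \<notin> {a'<..<b'}" using that by (auto simp: a0_def b0_def)
        then show ?thesis by (simp add: A_def plateau_eq_0 del: greaterThanLessThan_iff)
      qed
      have "(LINT x|lborel. A x) = 0"
        unfolding A_def using int_plateau by (simp add: m_def m'_def)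
      then obtain \<alpha> where \<alpha>: "\<And>x. (\<alpha> has_real_derivative A x) (at x)" "\<And>x. x \<notin> {a0<..<b0} \<Longrightarrow> \<alpha> x = 0"
        using compactly_supported_primitive[OF smooth_continuous_on[OF smooth_A] A0] by blast
      have smooth_\<alpha>: "smooth \<alpha>"
        by (rule smooth_real_deriv[OF \<alpha>(1) smooth_A])
      have "test_function ({0<..<1} \<times> {l<..<u}) (\<lambda>p. \<alpha> (fst p) * plateau n c d (snd p))"
      proof (rule test_function_product[OF smooth_\<alpha> smooth_plateau])
        show "\<alpha> x = 0" if "x \<notin> {a0..b0}" for x
          using that by (intro \<alpha>(2)) auto
        show "plateau n c d x = 0" if "x \<notin> {c..d}" for x
          using that by (intro plateau_eq_0) auto
        show "{a0..b0} \<times> {c..d} \<subseteq> {0<..<1} \<times> {l<..<u}"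
          using ab by (auto simp: a0_def b0_def)
      qed
      from weak[OF this]
      have weak': "(LINT p|lborel. v p * (A (fst p) * plateau n c d (snd p))) =
          - (LINT p|lborel. z p * (\<alpha> (fst p) * plateau n c d (snd p)))"
        by (simp only: frechet_derivative_product_fst[OF \<alpha>(1) smooth_plateau])
      have "0 < a0" using ab by (simp add: a0_def)
      have "(LINT p|lborel. (v p + V p) * (A (fst p) * plateau n c d (snd p))) = 0"
        unfolding V_def
        by (rule weak_derivative_fst_tested[OF z_meas v z[OF \<open>0 < a0\<close>] weak' \<alpha> smooth_continuous_on[OF smooth_A] A0
              smooth_continuous_on[OF smooth_plateau]])
           (use plateau_nonneg plateau_le_1 in auto)
      moreover have "(v p + V p) * (A (fst p) * plateau n c d (snd p)) =
          m' n * (D p * (plateau n a b (fst p) * plateau n c d (snd p))) -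
          m n * (D p * (plateau n a' b' (fst p) * plateau n c d (snd p)))" for p
        by (simp add: D_def A_def algebra_simps)
      ultimately show ?thesis
        using int_G ab by (simp add: G_def)
    qed
    moreover have "(\<lambda>n. m' n * G n a b) \<longlonglongrightarrow> (b' - a') * I a b c d"
      unfolding m'_def by (intro tendsto_mult lim_m lim_G ab)
    moreover have "(\<lambda>n. m n * G n a' b') \<longlonglongrightarrow> (b - a) * I a' b' c d"
      unfolding m_def by (intro tendsto_mult lim_m lim_G ab)
    ultimately show ?thesis
      using LIMSEQ_unique by simp
  qed
  \<comment> \<open>The average of D over the reference interval (1/4, 1/2), whose length explains
    the factor 4. Any interval with closure inside (0, 1) could take its place.\<close>
  define c where "c \<theta> = 4 * (LINT r|lborel. indicator {1/4<..<1/2} r * D (r, \<theta>))" for \<theta>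
  have c_meas[measurable]: "c \<in> borel_measurable borel"
    unfolding c_def by measurable
  have int_c: "integrable lborel c"
    unfolding c_def
    using int_D[of "1/4" "1/2"] unfolding lborel_prod[symmetric]
    by (intro integrable_mult_right lborel_pair.integrable_snd) (simp add: case_prod_beta')
  have rect_c: "integrable lborel (\<lambda>p. indicator {a<..<b} (fst p) * indicator J (snd p) * c (snd p))"
    if [measurable]: "J \<in> sets borel" for a b :: real and J
  proof -
    have "integrable lborel (indicator {a<..<b} :: real \<Rightarrow> real)"
      by (cases "a \<le> b") auto
    moreover have "integrable lborel (\<lambda>\<theta>. indicator J \<theta> * c \<theta>)"
      using int_c integrable_mult_indicator[of J lborel c] by simp
    ultimately show ?thesis
      using lborel_pair.integrable_mult_pair by (simp add: lborel_prod case_prod_beta' mult.assoc)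
  qed
  have I_c: "(LINT p|lborel. indicator {a<..<b} (fst p) * indicator {c1<..<d1} (snd p) * c (snd p)) =
      (b - a) * (4 * I (1/4) (1/2) c1 d1)" if "a < b" for a b c1 d1 :: real
  proof -
    have "(LINT p|lborel. indicator {a<..<b} (fst p) * indicator {c1<..<d1} (snd p) * c (snd p)) =
        (LINT \<theta>|lborel. LINT r|lborel. indicator {a<..<b} r * (indicator {c1<..<d1} \<theta> * c \<theta>))"
      using rect_c[of "{c1<..<d1}" a b] unfolding lborel_prod[symmetric]
      by (subst lborel_pair.integral_snd) (simp_all add: case_prod_beta' mult.assoc)
    also have "\<dots> = (b - a) * (LINT \<theta>|lborel. indicator {c1<..<d1} \<theta> * c \<theta>)"
      using that by simp
    also have "(LINT \<theta>|lborel. indicator {c1<..<d1} \<theta> * c \<theta>) =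
        4 * (LINT \<theta>|lborel. LINT r|lborel. indicator {1/4<..<1/2} r * indicator {c1<..<d1} \<theta> * D (r, \<theta>))"
      unfolding c_def by (simp add: mult_ac flip: integral_mult_right_zero)
    also have "(LINT \<theta>|lborel. LINT r|lborel. indicator {1/4<..<1/2} r * indicator {c1<..<d1} \<theta> * D (r, \<theta>)) =
        I (1/4) (1/2) c1 d1"
      using rect_D[of "1/4" "{c1<..<d1}" "1/2"] unfolding I_def lborel_prod[symmetric]
      by (subst lborel_pair.integral_snd) (simp_all add: case_prod_beta')
    finally show ?thesis .
  qed
  \<comment> \<open>Exhaustion by rectangles at positive distance from the boundary: D is known to
    be integrable only away from r = 0, and product tests must be supported inside the
    domain.\<close>
  define Q where "Q n = {inverse (real (Suc n))<..<1 - inverse (real (Suc n))} \<times>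
      {l + inverse (real (Suc n))<..<u - inverse (real (Suc n))}" for n
  have "AE p in lborel. indicator (Q n) p * (D p - c (snd p)) = 0" for n
  proof (rule AE_zero_if_box_integrals_zero)
    define \<epsilon> where "\<epsilon> = inverse (real (Suc n))"
    have \<epsilon>: "\<epsilon> > 0" by (simp add: \<epsilon>_def)
    have Q: "Q n = {\<epsilon><..<1 - \<epsilon>} \<times> {l + \<epsilon><..<u - \<epsilon>}"
      by (simp add: Q_def \<epsilon>_def)
    show "integrable lborel (\<lambda>p. indicator (Q n) p * (D p - c (snd p)))"
      using Bochner_Integration.integrable_diff[OF rect_D[OF \<epsilon>, of "{l + \<epsilon><..<u - \<epsilon>}" "1 - \<epsilon>"]
          rect_c[of "{l + \<epsilon><..<u - \<epsilon>}" \<epsilon> "1 - \<epsilon>"]]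
      by (simp add: Q indicator_times right_diff_distrib)
    fix x y :: "real \<times> real"
    \<comment> \<open>The intersection of the box with \<open>Q n\<close>, again a product of
      intervals, possibly empty.\<close>
    define a b c1 d1 where "a = max (fst x) \<epsilon>" and "b = min (fst y) (1 - \<epsilon>)"
      and "c1 = max (snd x) (l + \<epsilon>)" and "d1 = min (snd y) (u - \<epsilon>)"
    note defs = a_def b_def c1_def d1_def
    have eq: "indicator (box x y) p *\<^sub>R (indicator (Q n) p * (D p - c (snd p))) =
        indicator {a<..<b} (fst p) * indicator {c1<..<d1} (snd p) * D p -
        indicator {a<..<b} (fst p) * indicator {c1<..<d1} (snd p) * c (snd p)" for p
      unfolding box_real_prod Q by (auto simp: defs indicator_def mem_Times_iff)
    have "0 < a" using \<epsilon> by (simp add: defs)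
    have "(LINT p:box x y|lborel. indicator (Q n) p * (D p - c (snd p))) =
      I a b c1 d1 - (LINT p|lborel. indicator {a<..<b} (fst p) * indicator {c1<..<d1} (snd p) * c (snd p))"
      unfolding set_lebesgue_integral_def eq I_def
      by (rule Bochner_Integration.integral_diff) (use \<open>0 < a\<close> in \<open>auto intro!: rect_D rect_c\<close>)
    also have "\<dots> = 0"
    proof (cases "a < b")
      case True
      \<comment> \<open>Comparison with the reference interval: the right side is, up to the factor
        4, the integral of c over the same rectangle.\<close>
      have "(1/2 - 1/4) * I a b c1 d1 = (b - a) * I (1/4) (1/2) c1 d1"
        by (rule I_eq) (use \<epsilon> True in \<open>auto simp: defs\<close>)
      then show ?thesis
        unfolding I_c[OF True] by simp
    qed (simp add: I_def)
    finally show "(LINT p:box x y|lborel. indicator (Q n) p * (D p - c (snd p))) = 0" .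
  qed
  then have "AE p in lborel. \<forall>n. indicator (Q n) p * (D p - c (snd p)) = 0"
    unfolding AE_all_countable by blast
  then have "AE p in lborel. p \<in> {0<..<1} \<times> {l<..<u} \<longrightarrow> v p = c (snd p) - V p"
  proof eventually_elim
    case (elim p)
    show ?case
    proof
      assume p: "p \<in> {0<..<1} \<times> {l<..<u}"
      define \<epsilon> where "\<epsilon> = Min {fst p, 1 - fst p, snd p - l, u - snd p}"
      have "\<epsilon> > 0" using p by (auto simp: \<epsilon>_def)
      then obtain n where n: "inverse (real (Suc n)) < \<epsilon>"
        using reals_Archimedean by blast
      then have "p \<in> Q n"
        using p by (auto simp: \<epsilon>_def Q_def)
      then have "D p - c (snd p) = 0"
        using elim[rule_format, of n] by simp
      then show "v p = c (snd p) - V p"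
        by (simp add: D_def)
    qed
  qed
  then show ?thesis using c_meas by blast
qed

subsection \<open>Polar coordinates\<close>

text \<open>The origin causes no exception: its argument is 0 by convention, and
  \<open>angles\<close> is open at 0.\<close>

lemma Arg_in_angles_iff: "Arg x \<in> angles \<longleftrightarrow> 0 < Re x \<and> 0 < Im x"
proof (cases "x = 0")
  case False
  then show ?thesis
    using Re_Ln_pos_lt[OF False] Im_Ln_pos_lt[OF False] pi_gt_zero by (auto simp: Arg_eq_Im_Ln)
qed (simp add: Arg_zero)

lemma not_nonpos_Reals_if_Arg_in_angles: "Arg x \<in> angles \<Longrightarrow> x \<notin> \<real>\<^sub>\<le>\<^sub>0"
  unfolding Arg_in_angles_iff complex_nonpos_Reals_iff by auto

lemma mem_Omega_iff: "x \<in> Omega \<longleftrightarrow> Arg x \<in> angles \<and> norm x < 1"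
proof
  assume "Arg x \<in> angles \<and> norm x < 1"
  then show "x \<in> Omega"
    unfolding Omega_def
    by (intro CollectI exI[of _ "norm x"] exI[of _ "Arg x"], cases "x = 0")
       (auto simp: Arg_zero rcis_cmod_Arg)
qed (use pi_gt_zero in \<open>auto simp: Omega_def Arg_rcis\<close>)

text \<open>Positivity of \<open>R1\<close> forces r > 0; for negative r the point
  \<open>rcis r \<theta>\<close> would lie in the opposite direction and have another
  argument.\<close>

lemma mem_Omega'_iff:
  assumes "\<forall>\<theta>\<in>angles. 0 < R1 \<theta>"
  shows "x \<in> Omega' R1 R2 \<longleftrightarrow> Arg x \<in> angles \<and> R1 (Arg x) < norm x \<and> norm x < R2 (Arg x)"
proof
  assume "Arg x \<in> angles \<and> R1 (Arg x) < norm x \<and> norm x < R2 (Arg x)"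
  then show "x \<in> Omega' R1 R2"
    unfolding Omega'_def using rcis_cmod_Arg[of x] by force
next
  assume "x \<in> Omega' R1 R2"
  then obtain r \<theta> where x: "x = rcis r \<theta>" "R1 \<theta> < r" "r < R2 \<theta>" "\<theta> \<in> angles"
    by (auto simp: Omega'_def)
  then have "0 < r" using assms by force
  moreover from this have "Arg x = \<theta>"
    using x pi_gt_zero by (simp add: Arg_rcis)
  ultimately show "Arg x \<in> angles \<and> R1 (Arg x) < norm x \<and> norm x < R2 (Arg x)"
    using x by simp
qed

lemma open_quadrant: "open {x. Arg x \<in> angles}"
  unfolding Arg_in_angles_iff by (intro open_Collect_conj open_Collect_less continuous_intros)

lemma continuous_on_Arg_quadrant: "continuous_on {x. Arg x \<in> angles} Arg"
  by (intro continuous_at_imp_continuous_on ballI continuous_at_Arg not_nonpos_Reals_if_Arg_in_angles) blast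

lemma open_Omega: "open Omega"
proof -
  have eq: "Omega = {x. Arg x \<in> angles} \<inter> {x. norm x < 1}"
    by (auto simp: mem_Omega_iff)
  show ?thesis
    unfolding eq by (intro open_Int open_quadrant open_Collect_less continuous_intros)
qed

lemma open_Omega':
  assumes "\<forall>\<theta>\<in>angles. 0 < R1 \<theta>" and "continuous_on angles R1" "continuous_on angles R2"
  shows "open (Omega' R1 R2)"
proof -
  let ?S = "{x. Arg x \<in> angles}"
  have R: "continuous_on ?S (\<lambda>x. R1 (Arg x))" "continuous_on ?S (\<lambda>x. R2 (Arg x))"
    by (rule continuous_on_compose2[OF assms(2) continuous_on_Arg_quadrant]
        continuous_on_compose2[OF assms(3) continuous_on_Arg_quadrant]; blast)+
  obtain A where A: "open A" "A \<inter> ?S = {x \<in> ?S. R1 (Arg x) < norm x}"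
    using open_Collect_less_Int[OF R(1), of norm] by (auto intro: continuous_intros)
  obtain B where B: "open B" "B \<inter> ?S = {x \<in> ?S. norm x < R2 (Arg x)}"
    using open_Collect_less_Int[OF _ R(2), of norm] by (auto intro: continuous_intros)
  have "Omega' R1 R2 = {x \<in> ?S. R1 (Arg x) < norm x} \<inter> {x \<in> ?S. norm x < R2 (Arg x)}"
    using mem_Omega'_iff[OF assms(1)] by blast
  also have "\<dots> = (A \<inter> ?S) \<inter> (B \<inter> ?S)"
    by (simp only: A B)
  finally have eq: "Omega' R1 R2 = (A \<inter> ?S) \<inter> (B \<inter> ?S)" .
  show ?thesis
    unfolding eq by (intro open_Int A(1) B(1) open_quadrant)
qed

text \<open>The map from x to its polar coordinates is differentiable on the quadrant between spaces
  of equal dimension, so it sends null sets to null sets. No change of variables formula is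
  involved.\<close>

lemma AE_Omega_polar:
  assumes "AE x in lborel. x \<in> Omega \<longrightarrow> P (norm x) (Arg x)"
  shows "AE p in lborel. p \<in> {0<..<1} \<times> angles \<longrightarrow> P (fst p) (snd p)"
proof -
  define N where "N = {x \<in> Omega. \<not> P (norm x) (Arg x)}"
  \<comment> \<open>This is (|x|, Arg x), written through the complex logarithm because the latter
    is differentiable off its branch cut, which the quadrant avoids.\<close>
  let ?g = "\<lambda>x. (exp (Re (Ln x)), Im (Ln x))"
  from assms have "AE x in lebesgue. x \<in> Omega \<longrightarrow> P (norm x) (Arg x)"
    by (simp add: AE_completion_iff)
  then obtain M where "M \<in> null_sets lebesgue" "{x \<in> space lebesgue. \<not> (x \<in> Omega \<longrightarrow> P (norm x) (Arg x))} \<subseteq> M"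
    unfolding eventually_ae_filter by blast
  then have "negligible N"
    by (intro negligible_subset[of M N]) (auto simp: N_def negligible_iff_null_sets)
  moreover have "?g differentiable_on N"
  proof (rule differentiable_at_imp_differentiable_on)
    fix x assume "x \<in> N"
    then have "x \<notin> \<real>\<^sub>\<le>\<^sub>0"
      by (intro not_nonpos_Reals_if_Arg_in_angles) (simp add: N_def mem_Omega_iff)
    then have "(Ln has_derivative (*) (inverse x)) (at x)"
      using has_field_derivative_Ln by (simp add: has_field_derivative_def)
    then show "?g differentiable at x"
      unfolding differentiable_def
      by (intro exI) (rule has_derivative_Pair has_derivative_exp has_derivative_Re has_derivative_Im | assumption)+
  qed
  ultimately have "negligible (?g ` N)"
    by (intro negligible_differentiable_image_negligible) (auto simp: DIM_complex)
  then have "?g ` N \<in> null_sets lebesgue"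
    by (simp add: negligible_iff_null_sets)
  moreover have "p \<in> ?g ` N" if "p \<in> {0<..<1} \<times> angles" "\<not> P (fst p) (snd p)" for p
  proof
    let ?x = "rcis (fst p) (snd p)"
    have x: "norm ?x = fst p" "Arg ?x = snd p" "?x \<noteq> 0"
      using that pi_gt_zero by (auto simp: Arg_rcis)
    then show "p = ?g ?x"
      using that by (simp add: Arg_eq_Im_Ln[symmetric] prod_eq_iff)
    show "?x \<in> N"
      using that unfolding N_def mem_Collect_eq mem_Omega_iff x by auto
  qed
  ultimately have "AE p in lebesgue. p \<in> {0<..<1} \<times> angles \<longrightarrow> P (fst p) (snd p)"
    unfolding eventually_ae_filter by (intro bexI[of _ "?g ` N"]) auto
  then show ?thesis
    by (simp add: AE_completion_iff)
qed

text \<open>The target measure is concentrated on B, so T lands in B almost everywhere for \<mu>;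
  positivity of f turns this into Lebesgue-almost everywhere on \<open>Omega\<close>.\<close>

lemma transport_map_range:
  assumes T: "T \<in> transport_maps \<mu> \<nu>"
    and \<mu>: "\<mu> = density lborel (\<lambda>x. ennreal (f x) * indicator Omega x)"
    and \<nu>: "\<nu> = density lborel (\<lambda>x. ennreal (g x) * indicator B x)"
    and f: "continuous_on Omega f" "\<And>x. x \<in> Omega \<Longrightarrow> 0 < f x"
    and g: "continuous_on B g" and B: "open B"
  shows "AE x in lborel. x \<in> Omega \<longrightarrow> T x \<in> B"
proof -
  have dens: "(\<lambda>x. ennreal (h x) * indicator S x) \<in> borel_measurable lborel"
    if "open S" "continuous_on S h" for h :: "complex \<Rightarrow> real" and S
  proof -
    have "(\<lambda>x. indicator S x *\<^sub>R h x) \<in> borel_measurable borel"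
      using that by (intro borel_measurable_continuous_on_indicator) auto
    then have "(\<lambda>x. ennreal (indicator S x *\<^sub>R h x)) \<in> borel_measurable borel"
      by measurable
    moreover have "ennreal (indicator S x *\<^sub>R h x) = ennreal (h x) * indicator S x" for x
      by (auto simp: indicator_def)
    ultimately show ?thesis by simp
  qed
  have [measurable]: "B \<in> sets borel" using B by simp
  have "AE x in \<nu>. x \<in> B"
    unfolding \<nu> AE_density[OF dens[OF B g]] by (auto simp: indicator_def)
  moreover have \<nu>_eq: "\<nu> = distr \<mu> borel T" and [measurable]: "T \<in> \<mu> \<rightarrow>\<^sub>M borel"
    using T by (auto simp: transport_maps_def)
  ultimately have "AE x in distr \<mu> borel T. x \<in> B"
    by metis
  then have "AE x in \<mu>. T x \<in> B"
    by (subst (asm) AE_distr_iff) measurable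
  then show ?thesis
    unfolding \<mu> AE_density[OF dens[OF open_Omega f(1)]]
    by eventually_elim (use f(2) in \<open>auto simp: indicator_def\<close>)
qed

text \<open>T(x) has the argument of x and modulus \<phi>, so its membership in
  \<open>Omega' R1 R2\<close> is the pair of obstacle constraints at angle Arg x.\<close>

lemma radial_profile_between:
  assumes \<phi>: "radial_profile T \<phi>" and T: "AE x in lborel. x \<in> Omega \<longrightarrow> T x \<in> Omega' R1 R2"
    and R1: "\<forall>\<theta>\<in>angles. 0 < R1 \<theta>"
  shows "AE p in lborel. p \<in> {0<..<1} \<times> angles \<longrightarrow>
    R1 (snd p) \<le> \<phi> (fst p) (snd p) \<and> \<phi> (fst p) (snd p) \<le> R2 (snd p)"
proof (rule AE_Omega_polar[where P="\<lambda>r \<theta>. R1 \<theta> \<le> \<phi> r \<theta> \<and> \<phi> r \<theta> \<le> R2 \<theta>"])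
  show "AE x in lborel. x \<in> Omega \<longrightarrow> R1 (Arg x) \<le> \<phi> (norm x) (Arg x) \<and> \<phi> (norm x) (Arg x) \<le> R2 (Arg x)"
    using T \<phi>[unfolded radial_profile_def AE_completion_iff]
  proof eventually_elim
    case (elim x)
    show ?case
    proof
      assume x: "x \<in> Omega"
      then have "Arg x \<in> angles" by (simp add: mem_Omega_iff)
      then have "x \<noteq> 0" by (auto simp: Arg_zero)
      define c where "c = \<phi> (norm x) (Arg x)"
      have T: "c > 0" "T x = of_real (c / norm x) * x"
        using elim x by (auto simp: c_def scaleR_conv_of_real divide_inverse)
      then have "norm (T x) = c" "Arg (T x) = Arg x"
        using \<open>x \<noteq> 0\<close> by (simp_all add: norm_mult norm_divide Arg_times_of_real del: of_real_divide)
      then show "R1 (Arg x) \<le> \<phi> (norm x) (Arg x) \<and> \<phi> (norm x) (Arg x) \<le> R2 (Arg x)"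
        using mp[OF elim(1) x] unfolding mem_Omega'_iff[OF R1] c_def by (metis less_imp_le)
    qed
  qed
qed

text \<open>The infimum in \<open>F\<close> supplies some profile of finite energy; this carries the
  conclusion over to the given one.\<close>

lemma radial_profile_unique:
  assumes "radial_profile T \<phi>" "radial_profile T \<phi>'"
  shows "AE p in lborel. p \<in> {0<..<1} \<times> angles \<longrightarrow> \<phi> (fst p) (snd p) = \<phi>' (fst p) (snd p)"
proof (rule AE_Omega_polar[where P="\<lambda>r \<theta>. \<phi> r \<theta> = \<phi>' r \<theta>"])
  show "AE x in lborel. x \<in> Omega \<longrightarrow> \<phi> (norm x) (Arg x) = \<phi>' (norm x) (Arg x)"
    using assms[unfolded radial_profile_def AE_completion_iff]
  proof eventually_elim
    case (elim x)
    then show ?case by (auto simp: mem_Omega_iff Arg_zero)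
  qed
qed

subsection \<open>Weak derivatives and the minimization problem\<close>

text \<open>Local integrability speaks of compact subsets only; an increasing compact exhaustion of
  the open set passes measurability to the limit.\<close>

lemma locally_integrable_on_imp_measurable:
  fixes u :: "'a::euclidean_space \<Rightarrow> real"
  assumes u: "locally_integrable_on u U" and U: "open U"
  shows "u \<in> borel_measurable (lebesgue_on U)"
proof -
  obtain C where C: "\<And>n. compact (C n)" "\<And>n. C n \<subseteq> U" "\<And>n. C n \<subseteq> interior (C (Suc n))" "\<Union>(range C) = U"
    using open_Union_compact_subsets[OF U] by (metis (no_types))
  have "mono C"
    using C(3) interior_subset by (intro incseq_SucI) blast
  have "(\<lambda>x. indicator (C n) x *\<^sub>R u x) \<in> borel_measurable lebesgue" for n
    using u C(1,2)[of n] by (auto simp: locally_integrable_on_def set_integrable_def)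
  moreover have "(\<lambda>n. indicator (C n) x *\<^sub>R u x) \<longlonglongrightarrow> indicator U x *\<^sub>R u x" for x
    using LIMSEQ_indicator_incseq[OF \<open>mono C\<close>, of x] C(4) by (intro tendsto_scaleR) auto
  ultimately have "(\<lambda>x. indicator U x *\<^sub>R u x) \<in> borel_measurable lebesgue"
    by (rule borel_measurable_LIMSEQ_metric)
  then show ?thesis
    using U by (subst borel_measurable_restrict_space_iff) auto
qed

lemma locally_integrable_on_add:
  "locally_integrable_on u U \<Longrightarrow> locally_integrable_on w U \<Longrightarrow> locally_integrable_on (\<lambda>x. u x + w x) U"
  unfolding locally_integrable_on_def by (auto intro: set_integral_add)

lemma locally_integrable_on_mult:
  "locally_integrable_on u U \<Longrightarrow> locally_integrable_on (\<lambda>x. c * u x) U"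
  unfolding locally_integrable_on_def by auto

lemma set_integrable_mult_compact_support:
  fixes u \<eta> :: "'a::euclidean_space \<Rightarrow> real"
  assumes u: "locally_integrable_on u U" and K: "compact K" "K \<subseteq> U"
    and \<eta>: "continuous_on UNIV \<eta>" "\<And>x. x \<notin> K \<Longrightarrow> \<eta> x = 0"
  shows "set_integrable lebesgue U (\<lambda>x. u x * \<eta> x)"
proof -
  have "bounded (\<eta> ` K)"
    by (intro compact_imp_bounded compact_continuous_image continuous_on_subset[OF \<eta>(1)] K) auto
  then obtain M where M: "\<forall>x\<in>K. \<bar>\<eta> x\<bar> \<le> M"
    unfolding bounded_iff by auto
  have int: "integrable lebesgue (\<lambda>x. indicator K x *\<^sub>R u x)"
    using u K by (simp add: locally_integrable_on_def set_integrable_def)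
  have "\<eta> \<in> borel_measurable lebesgue"
    by (intro measurable_completion) (simp add: borel_measurable_continuous_onI[OF \<eta>(1)])
  then have meas: "(\<lambda>x. (indicator K x *\<^sub>R u x) * \<eta> x) \<in> borel_measurable lebesgue"
    using int by (intro borel_measurable_times) auto
  have "integrable lebesgue (\<lambda>x. (indicator K x *\<^sub>R u x) * \<eta> x)"
  proof (rule Bochner_Integration.integrable_bound[OF integrable_mult_left[OF int, of M] meas])
    show "AE x in lebesgue. norm ((indicator K x *\<^sub>R u x) * \<eta> x) \<le> norm ((indicator K x *\<^sub>R u x) * M)"
    proof (intro AE_I2)
      fix x
      show "norm ((indicator K x *\<^sub>R u x) * \<eta> x) \<le> norm ((indicator K x *\<^sub>R u x) * M)"
      proof (cases "x \<in> K")
        case True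
        then have "\<bar>\<eta> x\<bar> \<le> \<bar>M\<bar>" using M by force
        then show ?thesis
          using True mult_left_mono[of "\<bar>\<eta> x\<bar>" "\<bar>M\<bar>" "\<bar>u x\<bar>"] by (simp add: abs_mult)
      qed simp
    qed
  qed
  moreover have "(indicator K x *\<^sub>R u x) * \<eta> x = indicator U x *\<^sub>R (u x * \<eta> x)" for x
    using K(2) \<eta>(2)[of x] by (cases "x \<in> K") auto
  ultimately show ?thesis
    by (simp only: set_integrable_def)
qed

text \<open>Sums of weak derivatives need genuine integrability, since a non-integrable product
  would have integral 0 by default and additivity could fail. Off its support \<psi> vanishes on an
  open set, so its derivative vanishes there too.\<close>

lemma test_function_integrable:
  assumes \<psi>: "test_function U \<psi>" and u: "locally_integrable_on u U"
  shows "set_integrable lebesgue U (\<lambda>x. u x * \<psi> x)"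
    and "set_integrable lebesgue U (\<lambda>x. u x * frechet_derivative \<psi> (at x) v)"
proof -
  let ?K = "closure {x. \<psi> x \<noteq> 0}"
  have K: "compact ?K" "?K \<subseteq> U" and Ck: "\<And>k. Ck_function k \<psi>"
    using \<psi> by (auto simp: test_function_def)
  have 0: "\<psi> x = 0" if "x \<notin> ?K" for x
    using contra_subsetD[OF closure_subset that] by simp
  show "set_integrable lebesgue U (\<lambda>x. u x * \<psi> x)"
    by (rule set_integrable_mult_compact_support[OF u K Ck[of 0, unfolded Ck_function.simps] 0])
  have "frechet_derivative \<psi> (at x) v = 0" if "x \<notin> ?K" for x
  proof -
    have "frechet_derivative \<psi> (at x) = frechet_derivative (\<lambda>_. 0) (at x)"
    proof (rule frechet_derivative_transform_within_open)
      show "\<psi> differentiable at x" using Ck[of "Suc 0"] by simp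
      show "open (- ?K)" by (simp add: open_Compl)
      show "x \<in> - ?K" using that by (simp only: Compl_iff not_False_eq_True)
      show "\<psi> y = 0" if "y \<in> - ?K" for y
        by (rule 0[OF that[unfolded Compl_iff]])
    qed
    then show ?thesis by simp
  qed
  then show "set_integrable lebesgue U (\<lambda>x. u x * frechet_derivative \<psi> (at x) v)"
    using Ck[of "Suc 0"] by (intro set_integrable_mult_compact_support[OF u K]) simp_all
qed

lemma has_weak_derivative_add:
  assumes "has_weak_derivative u u' v U" "has_weak_derivative w w' v U"
  shows "has_weak_derivative (\<lambda>x. u x + w x) (\<lambda>x. u' x + w' x) v U"
  using assms unfolding has_weak_derivative_def
  by (auto simp: distrib_right set_integral_add test_function_integrable intro: locally_integrable_on_add)

lemma has_weak_derivative_cmult: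
  assumes "has_weak_derivative u u' v U"
  shows "has_weak_derivative (\<lambda>x. c * u x) (\<lambda>x. c * u' x) v U"
  using assms unfolding has_weak_derivative_def
  by (auto simp: mult.assoc intro: locally_integrable_on_mult)

section \<open>Norms and convexity of the obstacle problem\<close>

lemma L2_norm_sq_restrict: "L2_norm_sq u = (\<integral>\<^sup>+\<theta>. ennreal ((u \<theta>)\<^sup>2) \<partial>lebesgue_on angles)"
  unfolding L2_norm_sq_def by (subst nn_integral_restrict_space) auto

lemma H1_norm_sq_restrict:
  "H1_norm_sq u = (INF u'\<in>{u'. has_weak_derivative u u' 1 angles}.
     (\<integral>\<^sup>+\<theta>. ennreal ((u \<theta>)\<^sup>2 + (u' \<theta>)\<^sup>2) \<partial>lebesgue_on angles))"
  unfolding H1_norm_sq_def by (subst nn_integral_restrict_space) auto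

lemma in_L2_if_H1_norm_sq_finite:
  assumes "H1_norm_sq u < \<infinity>"
  shows "in_L2 u"
proof -
  obtain u' where u': "has_weak_derivative u u' 1 angles"
    and fin: "(\<integral>\<^sup>+\<theta>. ennreal ((u \<theta>)\<^sup>2 + (u' \<theta>)\<^sup>2) \<partial>lebesgue_on angles) < \<infinity>"
    using assms unfolding H1_norm_sq_restrict INF_less_iff by auto
  have "u \<in> borel_measurable (lebesgue_on angles)"
    using u' by (intro locally_integrable_on_imp_measurable) (auto simp: has_weak_derivative_def)
  moreover have "L2_norm_sq u \<le> (\<integral>\<^sup>+\<theta>. ennreal ((u \<theta>)\<^sup>2 + (u' \<theta>)\<^sup>2) \<partial>lebesgue_on angles)"
    unfolding L2_norm_sq_restrict by (intro nn_integral_mono ennreal_leI) auto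
  ultimately show ?thesis
    using fin by (auto simp: in_L2_def)
qed

text \<open>The parallelogram identity, applied to \<open>u\<close>, \<open>\<Phi>\<close> and their midpoint.\<close>

lemma L2_norm_sq_diff_minimizer_le:
  assumes \<Phi>: "is_H1_minimizer R1 R2 \<Phi>"
    and u: "AE \<theta> in lebesgue. \<theta> \<in> angles \<longrightarrow> R1 \<theta> \<le> u \<theta> \<and> u \<theta> \<le> R2 \<theta>"
  shows "ennreal (1/2) * L2_norm_sq (\<lambda>\<theta>. u \<theta> - \<Phi> \<theta>) \<le> H1_norm_sq u - H1_min R1 R2"
proof -
  define c where "c = (1/2::real)"
  have "0 \<le> c" by (simp add: c_def)
  define N where "N u u' = (\<integral>\<^sup>+\<theta>. ennreal ((u \<theta>)\<^sup>2 + (u' \<theta>)\<^sup>2) \<partial>lebesgue_on angles)" for u u' :: "real \<Rightarrow> real"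
  define K where "K = H1_min R1 R2"
  define L where "L = ennreal c * L2_norm_sq (\<lambda>\<theta>. u \<theta> - \<Phi> \<theta>)"
  have \<Phi>_between: "\<Phi> \<in> H1_between R1 R2"
    using \<Phi> by (simp add: is_H1_minimizer_def is_arg_min_def)
  have K: "H1_norm_sq \<Phi> = K"
    unfolding K_def H1_min_def
    using \<Phi> by (intro antisym INF_greatest INF_lower \<Phi>_between) (auto simp: is_H1_minimizer_def is_arg_min_def not_less)
  have K_fin: "K < \<infinity>"
    using \<Phi>_between by (simp add: H1_between_def flip: K)
  \<comment> \<open>\<open>H1_norm_sq\<close> is an infimum over weak derivatives, so the inequality
    is proved for every choice a, b; the infimum over b, then over a, is taken afterwards.\<close>
  have key: "K + K + L \<le> N u a + N \<Phi> b"
    if a: "has_weak_derivative u a 1 angles" and b: "has_weak_derivative \<Phi> b 1 angles" for a b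
  proof (cases "N u a + N \<Phi> b = \<infinity>")
    case False
    have [measurable]: "u \<in> borel_measurable (lebesgue_on angles)" "a \<in> borel_measurable (lebesgue_on angles)"
      "\<Phi> \<in> borel_measurable (lebesgue_on angles)" "b \<in> borel_measurable (lebesgue_on angles)"
      using a b by (auto simp: has_weak_derivative_def intro!: locally_integrable_on_imp_measurable)
    define m where "m \<theta> = (1/2) * (u \<theta> + \<Phi> \<theta>)" for \<theta>
    define m' where "m' \<theta> = (1/2) * (a \<theta> + b \<theta>)" for \<theta>
    have [measurable]: "m \<in> borel_measurable (lebesgue_on angles)" "m' \<in> borel_measurable (lebesgue_on angles)"
      unfolding m_def m'_def by measurable
    have m: "has_weak_derivative m m' 1 angles"
      unfolding m_def[abs_def] m'_def[abs_def]
      by (intro has_weak_derivative_cmult has_weak_derivative_add a b)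
    have "(N m m' + N m m') + L =
        (\<integral>\<^sup>+\<theta>. (ennreal ((m \<theta>)\<^sup>2 + (m' \<theta>)\<^sup>2) + ennreal ((m \<theta>)\<^sup>2 + (m' \<theta>)\<^sup>2)) +
          ennreal c * ennreal ((u \<theta> - \<Phi> \<theta>)\<^sup>2) \<partial>lebesgue_on angles)"
      unfolding N_def L_def L2_norm_sq_restrict by (simp add: nn_integral_add nn_integral_cmult)
    also have "\<dots> \<le> (\<integral>\<^sup>+\<theta>. ennreal ((u \<theta>)\<^sup>2 + (a \<theta>)\<^sup>2) + ennreal ((\<Phi> \<theta>)\<^sup>2 + (b \<theta>)\<^sup>2) \<partial>lebesgue_on angles)"
    proof (intro nn_integral_mono)
      fix \<theta>
      \<comment> \<open>The parallelogram identity for values and derivatives together. The term in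
        a - b is dropped, which leaves the \<open>L\<^sup>2\<close> distance with factor
        1/2.\<close>
      have "((m \<theta>)\<^sup>2 + (m' \<theta>)\<^sup>2) + ((m \<theta>)\<^sup>2 + (m' \<theta>)\<^sup>2) + c * (u \<theta> - \<Phi> \<theta>)\<^sup>2 + 1/2 * (a \<theta> - b \<theta>)\<^sup>2 =
          ((u \<theta>)\<^sup>2 + (a \<theta>)\<^sup>2) + ((\<Phi> \<theta>)\<^sup>2 + (b \<theta>)\<^sup>2)"
        unfolding m_def m'_def c_def by (simp add: power2_eq_square field_simps)
      then have "((m \<theta>)\<^sup>2 + (m' \<theta>)\<^sup>2) + ((m \<theta>)\<^sup>2 + (m' \<theta>)\<^sup>2) + c * (u \<theta> - \<Phi> \<theta>)\<^sup>2 \<le>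
          ((u \<theta>)\<^sup>2 + (a \<theta>)\<^sup>2) + ((\<Phi> \<theta>)\<^sup>2 + (b \<theta>)\<^sup>2)"
        using zero_le_power2[of "a \<theta> - b \<theta>"] by linarith
      then show "(ennreal ((m \<theta>)\<^sup>2 + (m' \<theta>)\<^sup>2) + ennreal ((m \<theta>)\<^sup>2 + (m' \<theta>)\<^sup>2)) +
          ennreal c * ennreal ((u \<theta> - \<Phi> \<theta>)\<^sup>2) \<le> ennreal ((u \<theta>)\<^sup>2 + (a \<theta>)\<^sup>2) + ennreal ((\<Phi> \<theta>)\<^sup>2 + (b \<theta>)\<^sup>2)"
        using \<open>0 \<le> c\<close> by (simp add: ennreal_leI flip: ennreal_plus ennreal_mult)
    qed
    also have "\<dots> = N u a + N \<Phi> b"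
      unfolding N_def by (simp add: nn_integral_add)
    finally have le: "(N m m' + N m m') + L \<le> N u a + N \<Phi> b" .
    have H1_m: "H1_norm_sq m \<le> N m m'"
      unfolding H1_norm_sq_restrict N_def by (rule INF_lower) (simp add: m)
    have "N m m' \<le> (N m m' + N m m') + L"
      by (simp add: add.assoc)
    then have "N m m' < \<infinity>"
      using le False by (metis infinity_ennreal_def le_less_trans less_top order_trans)
    then have "H1_norm_sq m < \<infinity>"
      using H1_m by (rule le_less_trans[rotated])
    moreover have "AE \<theta> in lebesgue. \<theta> \<in> angles \<longrightarrow> R1 \<theta> \<le> m \<theta> \<and> m \<theta> \<le> R2 \<theta>"
      using u \<Phi>_between[unfolded H1_between_def mem_Collect_eq, THEN conjunct2]
      by eventually_elim (auto simp: m_def field_simps)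
    ultimately have "m \<in> H1_between R1 R2"
      by (simp add: H1_between_def)
    then have "K \<le> H1_norm_sq m"
      unfolding K_def H1_min_def by (rule INF_lower)
    then have "K \<le> N m m'" using H1_m by (rule order_trans)
    then have "K + K + L \<le> N m m' + N m m' + L" by (intro add_mono order_refl)
    then show ?thesis using le by (rule order_trans)
  qed (simp only: infinity_ennreal_def top_greatest)
  have "K + L \<le> N u a" if a: "has_weak_derivative u a 1 angles" for a
  proof (cases "N u a = \<infinity>")
    case False
    \<comment> \<open>\<open>N u a\<close> is finite here, so it can be moved to the left and the
      infimum over b taken on the right. The finite K is then cancelled.\<close>
    have "K + K + L - N u a \<le> H1_norm_sq \<Phi>"
      unfolding H1_norm_sq_restrict N_def[symmetric]
      using key[OF a] False by (intro INF_greatest) (auto simp: ennreal_minus_le_iff)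
    then have "K + (K + L) \<le> K + N u a"
      unfolding K ennreal_minus_le_iff by (simp add: ac_simps)
    then show ?thesis
      unfolding ennreal_add_left_cancel_le using K_fin by auto
  qed simp
  then have "K + L \<le> H1_norm_sq u"
    unfolding H1_norm_sq_restrict N_def[symmetric] by (intro INF_greatest) auto
  then show ?thesis
    unfolding ennreal_le_minus_iff by (simp only: L_def K_def c_def add.commute simp_thms)
qed

subsection \<open>Curves in \<open>L\<^sup>2\<close> with finite energy\<close>

lemma L2_norm_sq_lborel: "L2_norm_sq u = (\<integral>\<^sup>+\<theta>\<in>angles. ennreal ((u \<theta>)\<^sup>2) \<partial>lborel)"
  unfolding L2_norm_sq_def by (rule nn_integral_completion)

lemma L2_norm_sq_cong_AE:
  assumes "AE \<theta> in lborel. \<theta> \<in> angles \<longrightarrow> u \<theta> = w \<theta>"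
  shows "L2_norm_sq u = L2_norm_sq w"
  unfolding L2_norm_sq_lborel
  by (rule nn_integral_cong_AE) (use assms in \<open>auto elim!: eventually_mono simp: indicator_def\<close>)

lemma L2_norm_sq_minus_commute: "L2_norm_sq (\<lambda>\<theta>. u \<theta> - w \<theta>) = L2_norm_sq (\<lambda>\<theta>. w \<theta> - u \<theta>)"
  by (simp add: L2_norm_sq_def power2_commute)

text \<open>Pointwise (a + b)^2 \<le> 2 a^2 + 2 b^2. For limits this serves as the triangle
  inequality and avoids square roots in \<open>ennreal\<close>.\<close>

lemma L2_norm_sq_add_le:
  assumes [measurable]: "u \<in> borel_measurable borel" "w \<in> borel_measurable borel"
  shows "L2_norm_sq (\<lambda>\<theta>. u \<theta> + w \<theta>) \<le> 2 * L2_norm_sq u + 2 * L2_norm_sq w"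
proof -
  have "L2_norm_sq (\<lambda>\<theta>. u \<theta> + w \<theta>) \<le>
      (\<integral>\<^sup>+\<theta>. 2 * (ennreal ((u \<theta>)\<^sup>2) * indicator angles \<theta>) + 2 * (ennreal ((w \<theta>)\<^sup>2) * indicator angles \<theta>) \<partial>lborel)"
    unfolding L2_norm_sq_lborel
  proof (intro nn_integral_mono)
    fix \<theta>
    have "(u \<theta> + w \<theta>)\<^sup>2 \<le> 2 * (u \<theta>)\<^sup>2 + 2 * (w \<theta>)\<^sup>2"
      using sum_squares_bound[of "u \<theta>" "w \<theta>"] by (simp add: power2_sum)
    then have "ennreal ((u \<theta> + w \<theta>)\<^sup>2) \<le> ennreal (2 * (u \<theta>)\<^sup>2 + 2 * (w \<theta>)\<^sup>2)"
      by (rule ennreal_leI)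
    also have "\<dots> = 2 * ennreal ((u \<theta>)\<^sup>2) + 2 * ennreal ((w \<theta>)\<^sup>2)"
      by (simp add: ennreal_mult)
    finally show "ennreal ((u \<theta> + w \<theta>)\<^sup>2) * indicator angles \<theta> \<le>
        2 * (ennreal ((u \<theta>)\<^sup>2) * indicator angles \<theta>) + 2 * (ennreal ((w \<theta>)\<^sup>2) * indicator angles \<theta>)"
      by (auto simp: indicator_def)
  qed
  also have "\<dots> = 2 * L2_norm_sq u + 2 * L2_norm_sq w"
    unfolding L2_norm_sq_lborel by (simp add: nn_integral_add nn_integral_cmult)
  finally show ?thesis .
qed

text \<open>Continuity from above of the measure with density h, which is finite on (0, 1), along
  the intervals (0, 1/(n+1)) decreasing to the empty set.\<close>

lemma nn_integral_near_0_tendsto_0: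
  fixes h :: "real \<Rightarrow> ennreal"
  assumes [measurable]: "h \<in> borel_measurable borel" and "(\<integral>\<^sup>+r\<in>{0<..<1}. h r \<partial>lborel) < \<infinity>"
  shows "((\<lambda>t. \<integral>\<^sup>+r\<in>{0<..<t}. h r \<partial>lborel) \<longlongrightarrow> 0) (at_right 0)"
proof (rule order_tendstoI)
  define M where "M = density lborel h"
  have M: "(\<integral>\<^sup>+r\<in>A. h r \<partial>lborel) = emeasure M A" if "A \<in> sets borel" for A
    unfolding M_def using that by (simp add: emeasure_density)
  fix e :: ennreal assume "0 < e"
  define A where "A n = {0<..<inverse (real (Suc n))}" for n
  have "(\<lambda>n. emeasure M (A n)) \<longlonglongrightarrow> emeasure M (\<Inter>n. A n)"
  proof (rule Lim_emeasure_decseq)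
    show "range A \<subseteq> sets M" by (auto simp: M_def A_def)
    have le: "inverse (real (Suc n)) \<le> inverse (real (Suc m))" if "m \<le> n" for m n
      using that by (simp add: field_simps)
    show "decseq A"
      unfolding decseq_def
    proof (intro allI impI)
      fix m n :: nat assume "m \<le> n"
      then show "A n \<subseteq> A m"
        unfolding A_def using less_le_trans[OF _ le] by (intro subsetI) (meson greaterThanLessThan_iff)
    qed
    have "emeasure M (A n) \<le> emeasure M {0<..<1}" for n
    proof (intro emeasure_mono)
      have "inverse (real (Suc n)) \<le> 1" by (simp add: field_simps)
      then show "A n \<subseteq> {0<..<1}"
        unfolding A_def by (intro subsetI) (meson greaterThanLessThan_iff less_le_trans)
    qed (simp add: M_def)
    then show "emeasure M (A n) \<noteq> \<infinity>" for n
      using assms(2) unfolding M[of "{0<..<1}", OF borel_open[OF open_greaterThanLessThan]]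
      by (metis infinity_ennreal_def leD le_less_trans order.irrefl)
  qed
  moreover have "(\<Inter>n. A n) = {}"
  proof -
    have "\<exists>n. x \<notin> A n" for x
    proof (cases "x > 0")
      case True
      then show ?thesis using reals_Archimedean[of x] by (auto simp: A_def not_less intro: less_imp_le)
    qed (auto simp: A_def)
    then show ?thesis by auto
  qed
  ultimately have "(\<lambda>n. emeasure M (A n)) \<longlonglongrightarrow> 0"
    by simp
  then have "\<forall>\<^sub>F n in sequentially. emeasure M (A n) < e"
    using \<open>0 < e\<close> by (rule order_tendstoD)
  then obtain n where n: "emeasure M (A n) < e"
    by (auto simp: eventually_sequentially)
  have "\<forall>\<^sub>F t in at_right 0. t < inverse (real (Suc n))"
    by (rule order_tendstoD(2)[OF tendsto_ident_at]) simp
  then show "\<forall>\<^sub>F t in at_right 0. (\<integral>\<^sup>+r\<in>{0<..<t}. h r \<partial>lborel) < e"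
  proof eventually_elim
    case (elim t)
    have "emeasure M {0<..<t} \<le> emeasure M (A n)"
      using elim by (intro emeasure_mono) (auto simp: M_def A_def)
    then show ?case using n by (simp add: M)
  qed
qed simp

text \<open>Near \<open>0\<close> the values \<open>\<parallel>\<psi> t - \<psi> 0\<parallel>\<^sup>2\<close> are compared with those at \<open>r \<in> (t, 2t)\<close>, whose
  average is controlled by the integral of \<open>h\<close>.\<close>

lemma L2_continuous_on_finite_energy:
  fixes \<psi> :: "real \<Rightarrow> real \<Rightarrow> real" and Z h :: "real \<Rightarrow> ennreal"
  assumes \<psi>[measurable]: "\<And>r. \<psi> r \<in> borel_measurable borel"
    and [measurable]: "Z \<in> borel_measurable borel" "h \<in> borel_measurable borel"
    and inc: "\<And>s t. 0 < s \<Longrightarrow> s \<le> t \<Longrightarrow>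
      L2_norm_sq (\<lambda>\<theta>. \<psi> t \<theta> - \<psi> s \<theta>) \<le> ennreal ((t - s) / s) * (\<integral>\<^sup>+r\<in>{s<..t}. Z r \<partial>lborel)"
    and Z: "(\<integral>\<^sup>+r. Z r \<partial>lborel) < \<infinity>"
    and h: "\<And>r. 0 < r \<Longrightarrow> L2_norm_sq (\<lambda>\<theta>. \<psi> r \<theta> - \<psi> 0 \<theta>) \<le> ennreal r * h r"
    and h_fin: "(\<integral>\<^sup>+r\<in>{0<..<1}. h r \<partial>lborel) < \<infinity>"
    and \<psi>0: "L2_norm_sq (\<psi> 0) < \<infinity>"
  shows "L2_continuous_on {0..1} \<psi>"
proof -
  define E where "E = (\<integral>\<^sup>+r. Z r \<partial>lborel)"
  define d where "d s t = L2_norm_sq (\<lambda>\<theta>. \<psi> s \<theta> - \<psi> t \<theta>)" for s t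
  define hh where "hh t = (\<integral>\<^sup>+r\<in>{0<..<t}. h r \<partial>lborel)" for t
  define ZZ where "ZZ t = (\<integral>\<^sup>+r\<in>{0<..<t}. Z r \<partial>lborel)" for t
  have tri: "d r t \<le> 2 * d r s + 2 * d s t" for r s t
    using L2_norm_sq_add_le[of "\<lambda>\<theta>. \<psi> r \<theta> - \<psi> s \<theta>" "\<lambda>\<theta>. \<psi> s \<theta> - \<psi> t \<theta>"] by (simp add: d_def)
  have near0: "d t 0 \<le> 4 * hh (2 * t) + 2 * ZZ (2 * t)" if t: "0 < t" for t
  proof -
    \<comment> \<open>On the window (r - t)/t is at most 1 and the weight r is at most 2t.
      \<open>tri\<close> contributes a factor 2 to each term, whence 4t.\<close>
    have *: "d t 0 \<le> ennreal (4 * t) * h r + 2 * ZZ (2 * t)" if r: "r \<in> {t<..<2 * t}" for r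
    proof -
      have "d t r = d r t"
        unfolding d_def by (rule L2_norm_sq_minus_commute)
      also have "\<dots> \<le> ennreal ((r - t) / t) * (\<integral>\<^sup>+x\<in>{t<..r}. Z x \<partial>lborel)"
        unfolding d_def using r t by (intro inc) auto
      also have "\<dots> \<le> 1 * ZZ (2 * t)"
        unfolding ZZ_def using r t
        by (intro mult_mono nn_integral_mono) (auto simp: indicator_def divide_le_eq intro!: ennreal_le_1[THEN iffD2])
      finally have "d t r \<le> ZZ (2 * t)" by simp
      moreover have "d r 0 \<le> ennreal (2 * t) * h r"
        using h[of r] r t by (auto simp: d_def intro!: order_trans[OF h] mult_right_mono ennreal_leI)
      ultimately have "2 * d t r + 2 * d r 0 \<le> 2 * ZZ (2 * t) + 2 * (ennreal (2 * t) * h r)"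
        by (intro add_mono mult_left_mono) auto
      also have "2 * (ennreal (2 * t) * h r) = ennreal (4 * t) * h r"
        using t by (simp add: mult.assoc[symmetric] ennreal_mult)
      finally show ?thesis
        using tri[of t 0 r] by (simp add: add.commute)
    qed
    \<comment> \<open>The left side of the pointwise bound is constant in r, so integrating over the
      window of length t and dividing by t removes the factor t.\<close>
    have "ennreal t * d t 0 = (\<integral>\<^sup>+r\<in>{t<..<2 * t}. d t 0 \<partial>lborel)"
      using t by (simp add: nn_integral_cmult_indicator mult.commute)
    also have "\<dots> \<le> (\<integral>\<^sup>+r. ennreal (4 * t) * (h r * indicator {0<..<2 * t} r) + 2 * ZZ (2 * t) * indicator {t<..<2 * t} r \<partial>lborel)"
      using * t by (intro nn_integral_mono) (auto simp: indicator_def)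
    also have "\<dots> = ennreal (4 * t) * hh (2 * t) + 2 * ZZ (2 * t) * ennreal t"
      unfolding hh_def using t by (simp add: nn_integral_add nn_integral_cmult nn_integral_cmult_indicator)
    also have "\<dots> = ennreal t * (4 * hh (2 * t) + 2 * ZZ (2 * t))"
      using t by (simp add: ennreal_mult distrib_left mult_ac)
    finally show ?thesis
      using t by (subst (asm) ennreal_mult_le_mult_iff) auto
  qed
  have ZZ_le: "ZZ t \<le> E" for t
    unfolding ZZ_def E_def by (intro nn_integral_mono) (auto simp: indicator_def)
  have inc': "d t s \<le> ennreal ((t - s) / s) * E" if "0 < s" "s \<le> t" for s t
  proof -
    have "d t s \<le> ennreal ((t - s) / s) * (\<integral>\<^sup>+r\<in>{s<..t}. Z r \<partial>lborel)"
      unfolding d_def by (rule inc[OF that])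
    also have "\<dots> \<le> ennreal ((t - s) / s) * E"
      unfolding E_def by (intro mult_left_mono nn_integral_mono) (auto simp: indicator_def)
    finally show ?thesis .
  qed
  have E: "E < top" using Z by (simp add: E_def)
  have inc_fin: "d s t < top" if "0 < s" "0 < t" for s t
  proof -
    have *: "d t s < top" if "0 < s" "s \<le> t" for s t
      using inc'[OF that] E by (intro le_less_trans[OF inc'[OF that]]) (simp add: ennreal_mult_less_top)
    have "d s t = d t s"
      unfolding d_def by (rule L2_norm_sq_minus_commute)
    then show ?thesis
      using *[of s t] *[of t s] that by (cases "s \<le> t") simp_all
  qed
  \<comment> \<open>One radius at finite distance from \<psi>(0) suffices, as the increments bound
    all others relative to it. The radius 1/4 has its window inside (0, 1), where h has finite
    integral.\<close>
  have "4 * hh (1/2) + 2 * ZZ (1/2) < top"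
  proof -
    have "hh (1/2) \<le> (\<integral>\<^sup>+r\<in>{0<..<1}. h r \<partial>lborel)"
      unfolding hh_def by (intro nn_integral_mono) (auto simp: indicator_def)
    then show ?thesis
      using h_fin le_less_trans[OF ZZ_le E, of "1/2"] by (auto simp: ennreal_mult_less_top intro: le_less_trans)
  qed
  then have "d (1/4) 0 < top"
    using near0[of "1/4"] by (auto intro: le_less_trans)
  have fin: "L2_norm_sq (\<psi> r) < \<infinity>" if "0 \<le> r" for r
  proof (cases "r = 0")
    case False
    have "d r 0 \<le> 2 * d r (1/4) + 2 * d (1/4) 0" by (rule tri)
    also have "\<dots> < top"
      using inc_fin[of r "1/4"] \<open>d (1/4) 0 < top\<close> that False by (simp add: ennreal_mult_less_top)
    finally have "2 * d r 0 + 2 * L2_norm_sq (\<psi> 0) < top"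
      using \<psi>0 by (simp add: ennreal_mult_less_top)
    moreover have "L2_norm_sq (\<psi> r) \<le> 2 * d r 0 + 2 * L2_norm_sq (\<psi> 0)"
      using L2_norm_sq_add_le[of "\<lambda>\<theta>. \<psi> r \<theta> - \<psi> 0 \<theta>" "\<psi> 0"] by (simp add: d_def)
    ultimately show ?thesis by (simp only: infinity_ennreal_def)
  qed (use \<psi>0 in simp)
  have in_L2: "in_L2 (\<psi> r)" if "0 \<le> r" for r
    using fin[OF that] \<psi>[of r] unfolding in_L2_def
    by (auto intro!: measurable_restrict_space1 measurable_completion)
  have cont0: "((\<lambda>s. d s 0) \<longlongrightarrow> 0) (at_right 0)"
  proof (rule tendsto_sandwich[OF _ _ tendsto_const])
    have lim2: "filterlim (\<lambda>t::real. 2 * t) (at_right 0) (at_right 0)"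
      by (auto simp: filterlim_at eventually_at_filter intro!: tendsto_eq_intros)
    have "(ZZ \<longlongrightarrow> 0) (at_right 0)" "(hh \<longlongrightarrow> 0) (at_right 0)"
      unfolding ZZ_def[abs_def] hh_def[abs_def]
      using le_less_trans[OF ZZ_le[of 1] E]
      by (intro nn_integral_near_0_tendsto_0 h_fin; simp add: ZZ_def)+
    then have "((\<lambda>t. ZZ (2 * t)) \<longlongrightarrow> 0) (at_right 0)" "((\<lambda>t. hh (2 * t)) \<longlongrightarrow> 0) (at_right 0)"
      using filterlim_compose[OF _ lim2] by auto
    then have "((\<lambda>t. 4 * hh (2 * t) + 2 * ZZ (2 * t)) \<longlongrightarrow> 4 * 0 + 2 * 0) (at_right 0)"
      by (intro tendsto_add ennreal_tendsto_cmult) auto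
    then show "((\<lambda>t. 4 * hh (2 * t) + 2 * ZZ (2 * t)) \<longlongrightarrow> 0) (at_right 0)"
      by simp
    show "\<forall>\<^sub>F t in at_right 0. d t 0 \<le> 4 * hh (2 * t) + 2 * ZZ (2 * t)"
      using near0 by (auto simp: eventually_at_filter)
  qed simp
  have cont: "((\<lambda>s. d s r) \<longlongrightarrow> 0) (at r)" if r: "0 < r" for r
  proof (rule tendsto_sandwich[OF _ _ tendsto_const])
    have "((\<lambda>s. \<bar>s - r\<bar> / (r / 2)) \<longlongrightarrow> \<bar>r - r\<bar> / (r / 2)) (at r)"
      using r by (intro tendsto_intros) auto
    then have "((\<lambda>s. ennreal (\<bar>s - r\<bar> / (r / 2)) * E) \<longlongrightarrow> ennreal (\<bar>r - r\<bar> / (r / 2)) * E) (at r)"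
      using E r by (intro tendsto_mult_ennreal tendsto_ennrealI tendsto_const) auto
    then show "((\<lambda>s. ennreal (\<bar>s - r\<bar> / (r / 2)) * E) \<longlongrightarrow> 0) (at r)"
      by simp
    \<comment> \<open>The increment estimate divides by the smaller of s and r; near r both exceed
      r/2, so one bound serves both sides.\<close>
    have "\<forall>\<^sub>F s in at r. r / 2 < s"
      using r by (intro order_tendstoD(1)[OF tendsto_ident_at]) simp
    then show "\<forall>\<^sub>F s in at r. d s r \<le> ennreal (\<bar>s - r\<bar> / (r / 2)) * E"
    proof eventually_elim
      case (elim s)
      show ?case
      proof (cases "r \<le> s")
        case True
        have "d s r \<le> ennreal ((s - r) / r) * E"
          using r True by (rule inc')
        also have "\<dots> \<le> ennreal (\<bar>s - r\<bar> / (r / 2)) * E"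
          using r True by (intro mult_right_mono ennreal_leI frac_le) auto
        finally show ?thesis .
      next
        case False
        have "d s r = d r s"
          unfolding d_def by (rule L2_norm_sq_minus_commute)
        also have "\<dots> \<le> ennreal ((r - s) / s) * E"
          using r elim False by (intro inc') auto
        also have "\<dots> \<le> ennreal (\<bar>s - r\<bar> / (r / 2)) * E"
          using r elim False by (intro mult_right_mono ennreal_leI frac_le) auto
        finally show ?thesis .
      qed
    qed
  qed simp
  show ?thesis
    unfolding L2_continuous_on_def
  proof (intro conjI ballI)
    fix r :: real assume r: "r \<in> {0..1}"
    then show "in_L2 (\<psi> r)" by (intro in_L2) simp
    show "((\<lambda>s. L2_norm_sq (\<lambda>\<theta>. \<psi> s \<theta> - \<psi> r \<theta>)) \<longlongrightarrow> 0) (at r within {0..1})"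
    proof (cases "r = 0")
      case True
      have "at 0 within {0..1} \<le> at_right (0::real)"
        by (auto simp: le_filter_def eventually_at_filter elim!: eventually_mono)
      from tendsto_mono[OF this cont0] show ?thesis
        unfolding d_def True .
    next
      case False
      then show ?thesis
        using Lim_at_imp_Lim_at_within[OF cont[of r]] r unfolding d_def by simp
    qed
  qed
qed

text \<open>Cauchy-Schwarz on each fibre over (s, t] gives the factor t - s. Inserting the weight
  through 1 \<le> x/s costs 1/s, and Tonelli exchanges the integrals in x and \<theta>.\<close>

lemma primitive_increment_le:
  fixes z :: "real \<times> real \<Rightarrow> real"
  defines "V \<equiv> \<lambda>r \<theta>. LINT s|lborel. (if r < s then z (s, \<theta>) else 0)"
  assumes z: "z \<in> borel_measurable borel"
    and int: "\<And>\<delta>. \<delta> > 0 \<Longrightarrow> integrable lborel (\<lambda>p. indicator {\<delta><..} (fst p) * z p)"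
    and st: "0 < s" "s \<le> t"
  shows "(\<integral>\<^sup>+\<theta>. ennreal ((V s \<theta> - V t \<theta>)\<^sup>2) \<partial>lborel) \<le> ennreal ((t - s) / s) *
    (\<integral>\<^sup>+r\<in>{s<..t}. ennreal r * (\<integral>\<^sup>+\<theta>. ennreal ((z (r, \<theta>))\<^sup>2) \<partial>lborel) \<partial>lborel)"
proof -
  have [measurable]: "z \<in> borel_measurable (borel \<Otimes>\<^sub>M borel)"
    using z by (simp add: borel_prod)
  let ?e = "\<lambda>x \<theta>. ennreal x * ennreal ((z (x, \<theta>))\<^sup>2) * indicator {s<..t} x"
  have "AE \<theta> in lborel. integrable lborel (\<lambda>x. indicator {s / 2<..} x * z (x, \<theta>))"
    using int[of "s / 2"] st unfolding lborel_prod[symmetric]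
    by (intro lborel_pair.AE_integrable_snd) (simp add: case_prod_beta')
  then have "AE \<theta> in lborel. ennreal ((V s \<theta> - V t \<theta>)\<^sup>2) \<le> ennreal ((t - s) / s) * (\<integral>\<^sup>+x. ?e x \<theta> \<partial>lborel)"
  proof eventually_elim
    case (elim \<theta>)
    have int': "integrable lborel (\<lambda>x. if r < x then z (x, \<theta>) else 0)" if "s \<le> r" for r
    proof -
      have "integrable lborel (\<lambda>x. indicator {r<..} x *\<^sub>R (indicator {s / 2<..} x * z (x, \<theta>)))"
        using elim by (intro integrable_mult_indicator) auto
      moreover have "indicator {r<..} x *\<^sub>R (indicator {s / 2<..} x * z (x, \<theta>)) = (if r < x then z (x, \<theta>) else 0)" for x
        using st that by (auto simp: indicator_def)
      ultimately show ?thesis by simp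
    qed
    let ?q = "\<lambda>x. (if s < x then z (x, \<theta>) else 0) - (if t < x then z (x, \<theta>) else 0)"
    have q: "?q x = indicator {s<..t} x * z (x, \<theta>)" for x
      using st by (auto simp: indicator_def)
    have int_q: "integrable lborel ?q"
      using int'[of s] int'[of t] st by (intro Bochner_Integration.integrable_diff) auto
    have "V s \<theta> - V t \<theta> = (LINT x|lborel. ?q x)"
      unfolding V_def using int'[of s] int'[of t] st by (subst Bochner_Integration.integral_diff) auto
    then have "ennreal \<bar>V s \<theta> - V t \<theta>\<bar> \<le> (\<integral>\<^sup>+x. ennreal (norm (?q x)) \<partial>lborel)"
      using integral_norm_bound_ennreal[OF int_q] by simp
    also have "\<dots> = (\<integral>\<^sup>+x. indicator {s<..t} x * ennreal (norm (?q x)) \<partial>lborel)"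
      by (intro nn_integral_cong) (auto simp: q indicator_def)
    finally have "(ennreal \<bar>V s \<theta> - V t \<theta>\<bar>)\<^sup>2 \<le> (\<integral>\<^sup>+x. indicator {s<..t} x * ennreal (norm (?q x)) \<partial>lborel)\<^sup>2"
      by (intro power_mono) auto
    also have "\<dots> \<le> (\<integral>\<^sup>+x. (indicator {s<..t} x)\<^sup>2 \<partial>lborel) * (\<integral>\<^sup>+x. (ennreal (norm (?q x)))\<^sup>2 \<partial>lborel)"
      using int_q by (intro Cauchy_Schwarz_nn_integral) auto
    also have "(\<integral>\<^sup>+x. (indicator {s<..t} x)\<^sup>2 \<partial>lborel) = (\<integral>\<^sup>+x. indicator {s<..t} x \<partial>lborel)"
      by (intro nn_integral_cong) (auto simp: indicator_def)
    also have "\<dots> = ennreal (t - s)"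
      using st by simp
    also have "(\<integral>\<^sup>+x. (ennreal (norm (?q x)))\<^sup>2 \<partial>lborel) \<le> (\<integral>\<^sup>+x. ennreal (1 / s) * ?e x \<theta> \<partial>lborel)"
    proof (intro nn_integral_mono)
      fix x
      show "(ennreal (norm (?q x)))\<^sup>2 \<le> ennreal (1 / s) * ?e x \<theta>"
      proof (cases "x \<in> {s<..t}")
        case True
        then have "1 \<le> 1 / s * x" using st by (simp add: field_simps)
        then have "1 * (z (x, \<theta>))\<^sup>2 \<le> (1 / s * x) * (z (x, \<theta>))\<^sup>2"
          by (rule mult_right_mono) simp
        then have "ennreal ((z (x, \<theta>))\<^sup>2) \<le> ennreal ((1 / s * x) * (z (x, \<theta>))\<^sup>2)"
          by (intro ennreal_leI) simp
        also have "\<dots> = ennreal (1 / s) * (ennreal x * ennreal ((z (x, \<theta>))\<^sup>2))"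
        proof -
          have nonneg: "0 \<le> 1 / s" "0 \<le> x" using st True by auto
          show ?thesis
            unfolding ennreal_mult[OF mult_nonneg_nonneg[OF nonneg] zero_le_power2] ennreal_mult[OF nonneg]
            by (rule mult.assoc)
        qed
        finally show ?thesis
          using True st by (simp add: ennreal_power)
      qed (use q[of x] in simp)
    qed
    also have "\<dots> = ennreal (1 / s) * (\<integral>\<^sup>+x. ?e x \<theta> \<partial>lborel)"
      by (simp add: nn_integral_cmult)
    also have "ennreal (t - s) * (ennreal (1 / s) * (\<integral>\<^sup>+x. ?e x \<theta> \<partial>lborel)) = ennreal ((t - s) / s) * (\<integral>\<^sup>+x. ?e x \<theta> \<partial>lborel)"
      using st by (simp add: mult.assoc[symmetric] flip: ennreal_mult)
    finally show ?case
      by (simp add: ennreal_power mult_left_mono)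
  qed
  then have "(\<integral>\<^sup>+\<theta>. ennreal ((V s \<theta> - V t \<theta>)\<^sup>2) \<partial>lborel) \<le> (\<integral>\<^sup>+\<theta>. ennreal ((t - s) / s) * (\<integral>\<^sup>+x. ?e x \<theta> \<partial>lborel) \<partial>lborel)"
    by (rule nn_integral_mono_AE)
  also have "\<dots> = ennreal ((t - s) / s) * (\<integral>\<^sup>+\<theta>. (\<integral>\<^sup>+x. ?e x \<theta> \<partial>lborel) \<partial>lborel)"
    by (rule nn_integral_cmult) measurable
  also have "(\<integral>\<^sup>+\<theta>. (\<integral>\<^sup>+x. ?e x \<theta> \<partial>lborel) \<partial>lborel) = (\<integral>\<^sup>+x. (\<integral>\<^sup>+\<theta>. ?e x \<theta> \<partial>lborel) \<partial>lborel)"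
    by (rule lborel_pair.Fubini') measurable
  also have "\<dots> = (\<integral>\<^sup>+r\<in>{s<..t}. ennreal r * (\<integral>\<^sup>+\<theta>. ennreal ((z (r, \<theta>))\<^sup>2) \<partial>lborel) \<partial>lborel)"
    by (simp add: nn_integral_cmult nn_integral_multc)
  finally show ?thesis .
qed

subsection \<open>Borel versions\<close>

text \<open>Weak derivatives are formulated for completed Lebesgue measure, whereas Fubini is
  applied to products of \<open>lborel\<close>. Extension by 0 turns integrals over U into integrals
  over the whole space.\<close>

lemma ex_Borel_version:
  fixes u :: "'a::euclidean_space \<Rightarrow> real"
  assumes u: "u \<in> borel_measurable (lebesgue_on U)" and U: "U \<in> sets borel"
  shows "\<exists>v\<in>borel_measurable borel. (\<forall>x. x \<notin> U \<longrightarrow> v x = 0) \<and> (AE x in lborel. x \<in> U \<longrightarrow> v x = u x)"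
proof -
  have "(\<lambda>x. indicator U x *\<^sub>R u x) \<in> borel_measurable lebesgue"
    using u U by (subst (asm) borel_measurable_restrict_space_iff) auto
  then obtain v' where v': "v' \<in> borel_measurable lborel" "AE x in lborel. indicator U x *\<^sub>R u x = v' x"
    using completion_ex_borel_measurable_real by blast
  have "(\<lambda>x. indicator U x * v' x) \<in> borel_measurable borel"
    using v'(1) U by (intro borel_measurable_times) auto
  moreover have "AE x in lborel. x \<in> U \<longrightarrow> indicator U x * v' x = u x"
    using v'(2) by eventually_elim auto
  ultimately show ?thesis
    by (intro bexI[of _ "\<lambda>x. indicator U x * v' x"]) auto
qed

lemma set_integral_Borel_version:
  fixes u v D :: "'a::euclidean_space \<Rightarrow> real"
  assumes u: "u \<in> borel_measurable (lebesgue_on U)" and U: "U \<in> sets borel"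
    and v: "v \<in> borel_measurable borel" "\<And>x. x \<notin> U \<Longrightarrow> v x = 0" "AE x in lborel. x \<in> U \<longrightarrow> v x = u x"
    and D: "D \<in> borel_measurable borel"
  shows "(LINT x:U|lebesgue. u x * D x) = (LINT x|lborel. v x * D x)"
proof -
  have meas: "(\<lambda>x. v x * D x) \<in> borel_measurable lborel"
    using v(1) D by simp
  have "(\<lambda>x. indicator U x *\<^sub>R u x) \<in> borel_measurable lebesgue"
    using u U by (subst (asm) borel_measurable_restrict_space_iff) auto
  moreover have "D \<in> borel_measurable lebesgue"
    using D by (intro measurable_completion) simp
  ultimately have "(\<lambda>x. (indicator U x *\<^sub>R u x) * D x) \<in> borel_measurable lebesgue"
    by (rule borel_measurable_times)
  then have "(LINT x:U|lebesgue. u x * D x) = (LINT x|lebesgue. v x * D x)"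
    unfolding set_lebesgue_integral_def
  proof (intro integral_cong_AE)
    show "AE x in lebesgue. indicator U x *\<^sub>R (u x * D x) = v x * D x"
      unfolding AE_completion_iff using v(3) by eventually_elim (use v(2) in \<open>auto simp: indicator_def\<close>)
    show "(\<lambda>x. v x * D x) \<in> borel_measurable lebesgue"
      using meas by (rule measurable_completion)
  qed (simp add: mult.assoc)
  also have "\<dots> = (LINT x|lborel. v x * D x)"
    by (rule integral_completion[OF meas])
  finally show ?thesis .
qed

lemma has_weak_derivative_Borel_version:
  assumes "has_weak_derivative u w e U" and U: "open U"
    and u: "u' \<in> borel_measurable borel" "\<And>x. x \<notin> U \<Longrightarrow> u' x = 0" "AE x in lborel. x \<in> U \<longrightarrow> u' x = u x"
    and w: "w' \<in> borel_measurable borel" "\<And>x. x \<notin> U \<Longrightarrow> w' x = 0" "AE x in lborel. x \<in> U \<longrightarrow> w' x = w x"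
    and \<psi>: "test_function U \<psi>"
  shows "(LINT x|lborel. u' x * frechet_derivative \<psi> (at x) e) = - (LINT x|lborel. w' x * \<psi> x)"
proof -
  have "Ck_function 0 \<psi>" "Ck_function (Suc 0) \<psi>"
    using \<psi> unfolding test_function_def by blast+
  then have \<psi>_meas: "\<psi> \<in> borel_measurable borel"
    and \<psi>'_meas: "(\<lambda>x. frechet_derivative \<psi> (at x) e) \<in> borel_measurable borel"
    by (auto intro: borel_measurable_continuous_onI)
  have u_meas: "u \<in> borel_measurable (lebesgue_on U)" and w_meas: "w \<in> borel_measurable (lebesgue_on U)"
    using assms(1) U by (auto simp: has_weak_derivative_def intro: locally_integrable_on_imp_measurable)
  have "(LINT x:U|lebesgue. u x * frechet_derivative \<psi> (at x) e) = - (LINT x:U|lebesgue. w x * \<psi> x)"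
    using assms(1) \<psi> by (simp add: has_weak_derivative_def)
  moreover have "(LINT x:U|lebesgue. u x * frechet_derivative \<psi> (at x) e) = (LINT x|lborel. u' x * frechet_derivative \<psi> (at x) e)"
    by (rule set_integral_Borel_version[OF u_meas borel_open[OF U] _ _ _ \<psi>'_meas]) (fact u)+
  moreover have "(LINT x:U|lebesgue. w x * \<psi> x) = (LINT x|lborel. w' x * \<psi> x)"
    by (rule set_integral_Borel_version[OF w_meas borel_open[OF U] _ _ _ \<psi>_meas]) (fact w)+
  ultimately show ?thesis by simp
qed

section \<open>The radial energy on fibres\<close>

lemma AE_lborel_pair:
  fixes P :: "real \<times> real \<Rightarrow> bool"
  assumes "AE p in lborel. P p"
  shows "AE r in lborel. AE \<theta> in lborel. P (r, \<theta>)"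
  using assms unfolding lborel_prod[symmetric] by (rule lborel_pair.AE_pair)

lemma radial_energy_Borel_version:
  assumes z[measurable]: "z \<in> borel_measurable borel"
    and supp: "\<And>p. p \<notin> {0<..<1} \<times> angles \<Longrightarrow> z p = 0"
    and ae: "AE p in lborel. p \<in> {0<..<1} \<times> angles \<longrightarrow> z p = w p"
  shows "(\<integral>\<^sup>+r\<in>{0<..<1}. L2_norm_sq (\<lambda>\<theta>. w (r, \<theta>)) * ennreal r \<partial>lebesgue) =
    (\<integral>\<^sup>+r. ennreal r * (\<integral>\<^sup>+\<theta>. ennreal ((z (r, \<theta>))\<^sup>2) \<partial>lborel) \<partial>lborel)"
proof -
  have "AE r in lborel. L2_norm_sq (\<lambda>\<theta>. w (r, \<theta>)) * ennreal r * indicator {0<..<1} r =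
      ennreal r * (\<integral>\<^sup>+\<theta>. ennreal ((z (r, \<theta>))\<^sup>2) \<partial>lborel)"
    using AE_lborel_pair[OF ae]
  proof eventually_elim
    case (elim r)
    show ?case
    proof (cases "r \<in> {0<..<1}")
      case True
      have "L2_norm_sq (\<lambda>\<theta>. w (r, \<theta>)) = L2_norm_sq (\<lambda>\<theta>. z (r, \<theta>))"
        using elim True by (intro L2_norm_sq_cong_AE) (auto elim!: eventually_mono)
      also have "\<dots> = (\<integral>\<^sup>+\<theta>. ennreal ((z (r, \<theta>))\<^sup>2) \<partial>lborel)"
        unfolding L2_norm_sq_lborel using supp[of "(r, _)"]
        by (intro nn_integral_cong) (auto simp: indicator_def)
      finally show ?thesis
        using True by (simp add: mult.commute)
    next
      case False
      then have "z (r, \<theta>) = 0" for \<theta> by (intro supp) auto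
      then show ?thesis using False by simp
    qed
  qed
  then show ?thesis
    unfolding nn_integral_completion by (rule nn_integral_cong_AE)
qed

text \<open>Beyond \<delta> one has |z| \<le> 1 + z^2 \<le> 1 + (r/\<delta>) z^2 on a rectangle of
  finite area. The cut-off is essential: near 0 the function 1/(r log(1/r)) has finite weighted
  energy but infinite integral.\<close>

lemma integrable_away_from_0:
  fixes z :: "real \<times> real \<Rightarrow> real"
  assumes z: "z \<in> borel_measurable borel"
    and supp: "\<And>p. p \<notin> {0<..<1} \<times> angles \<Longrightarrow> z p = 0"
    and fin: "(\<integral>\<^sup>+r. ennreal r * (\<integral>\<^sup>+\<theta>. ennreal ((z (r, \<theta>))\<^sup>2) \<partial>lborel) \<partial>lborel) < \<infinity>"
    and \<delta>: "\<delta> > 0"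
  shows "integrable lborel (\<lambda>p. indicator {\<delta><..} (fst p) * z p)"
proof (rule integrableI_bounded)
  have [measurable]: "z \<in> borel_measurable (borel \<Otimes>\<^sub>M borel)"
    using z by (simp add: borel_prod)
  show "(\<lambda>p. indicator {\<delta><..} (fst p) * z p) \<in> borel_measurable lborel"
    using z by (auto intro!: borel_measurable_times borel_measurable_fst_comp)
  let ?Q = "{0<..<1} \<times> angles :: (real \<times> real) set"
  have "(\<integral>\<^sup>+p. ennreal (norm (indicator {\<delta><..} (fst p) * z p)) \<partial>lborel) \<le>
      (\<integral>\<^sup>+p. indicator ?Q p + ennreal (1 / \<delta>) * (ennreal (fst p) * ennreal ((z p)\<^sup>2)) \<partial>(lborel \<Otimes>\<^sub>M lborel))"
    unfolding lborel_prod
  proof (intro nn_integral_mono)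
    fix p :: "real \<times> real"
    show "ennreal (norm (indicator {\<delta><..} (fst p) * z p)) \<le>
        indicator ?Q p + ennreal (1 / \<delta>) * (ennreal (fst p) * ennreal ((z p)\<^sup>2))"
    proof (cases "p \<in> ?Q \<and> \<delta> < fst p")
      case True
      then have "1 \<le> 1 / \<delta> * fst p" using \<delta> by (simp add: field_simps)
      then have "1 * (z p)\<^sup>2 \<le> (1 / \<delta> * fst p) * (z p)\<^sup>2"
        by (rule mult_right_mono) simp
      moreover have "\<bar>z p\<bar> \<le> 1 + (z p)\<^sup>2"
        using zero_le_power2[of "\<bar>z p\<bar> - 1"] abs_ge_zero[of "z p"] unfolding power2_diff power2_abs one_power2 mult_1_right by linarith
      ultimately have "\<bar>z p\<bar> \<le> 1 + 1 / \<delta> * (fst p * (z p)\<^sup>2)"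
        by (simp add: mult.assoc)
      then have "ennreal \<bar>z p\<bar> \<le> ennreal (1 + 1 / \<delta> * (fst p * (z p)\<^sup>2))"
        by (rule ennreal_leI)
      also have "\<dots> = 1 + ennreal (1 / \<delta>) * (ennreal (fst p) * ennreal ((z p)\<^sup>2))"
      proof -
        have nonneg: "0 \<le> 1 / \<delta>" "0 \<le> fst p" using True \<delta> by auto
        note * = mult_nonneg_nonneg[OF nonneg(2) zero_le_power2[of "z p"]]
        show ?thesis
          unfolding ennreal_plus[OF zero_le_one mult_nonneg_nonneg[OF nonneg(1) *]]
            ennreal_mult[OF nonneg(1) *] ennreal_mult[OF nonneg(2) zero_le_power2] ennreal_1 ..
      qed
      finally show ?thesis using True by simp
    next
      case False
      then show ?thesis using supp[of p] by (auto simp: indicator_def)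
    qed
  qed
  also have "\<dots> = emeasure (lborel \<Otimes>\<^sub>M lborel) ?Q +
      ennreal (1 / \<delta>) * (\<integral>\<^sup>+p. ennreal (fst p) * ennreal ((z p)\<^sup>2) \<partial>(lborel \<Otimes>\<^sub>M lborel))"
    by (simp add: nn_integral_add nn_integral_cmult)
  also have "emeasure (lborel \<Otimes>\<^sub>M lborel) ?Q = ennreal (pi / 2)"
    using pi_gt_zero by (simp add: lborel.emeasure_pair_measure_Times)
  also have "(\<integral>\<^sup>+p. ennreal (fst p) * ennreal ((z p)\<^sup>2) \<partial>(lborel \<Otimes>\<^sub>M lborel)) =
      (\<integral>\<^sup>+r. ennreal r * (\<integral>\<^sup>+\<theta>. ennreal ((z (r, \<theta>))\<^sup>2) \<partial>lborel) \<partial>lborel)"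
    by (subst lborel.nn_integral_fst[symmetric]) (auto simp: nn_integral_cmult)
  also have "ennreal (pi / 2) + ennreal (1 / \<delta>) * \<dots> < \<infinity>"
    using fin by (simp add: ennreal_mult_less_top)
  finally show "(\<integral>\<^sup>+p. ennreal (norm (indicator {\<delta><..} (fst p) * z p)) \<partial>lborel) < \<infinity>" .
qed

subsection \<open>Continuity up to the origin\<close>

theorem proposition1p1:
  fixes R1 R2 :: "real \<Rightarrow> real" and f g :: "complex \<Rightarrow> real"
    and \<mu> \<nu> :: "complex measure"
    and T :: "complex \<Rightarrow> complex" and \<phi> :: "real \<Rightarrow> real \<Rightarrow> real" and \<Phi> :: "real \<Rightarrow> real"
  assumes R_pos: "\<forall>\<theta>\<in>{0..pi/2}. R1 \<theta> > 0 \<and> R2 \<theta> > 0"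
    and R1_lipschitz: "\<exists>L. L-lipschitz_on {0..pi/2} R1"
    and R2_lipschitz: "\<exists>L. L-lipschitz_on {0..pi/2} R2"
    and inf_R1: "(INF \<theta>\<in>{0..pi/2}. R1 \<theta>) > 1"
    and inf_R2: "(INF \<theta>\<in>{0..pi/2}. R2 \<theta>) > (SUP \<theta>\<in>{0..pi/2}. R1 \<theta>)"
    and R1'_BV: "\<exists>h. bounded_variation_on {0..pi/2} h \<and>
          (AE \<theta> in lebesgue. \<theta> \<in> {0<..<pi/2} \<longrightarrow> (R1 has_real_derivative h \<theta>) (at \<theta>))"
    and \<mu>_prob: "prob_space \<mu>" and \<nu>_prob: "prob_space \<nu>"
    and \<mu>_density: "\<mu> = density lborel (\<lambda>x. ennreal (f x) * indicator Omega x)"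
    and \<nu>_density: "\<nu> = density lborel (\<lambda>x. ennreal (g x) * indicator (Omega' R1 R2) x)"
    and f_lipschitz: "\<exists>L. L-lipschitz_on (closure Omega) f"
    and g_lipschitz: "\<exists>L. L-lipschitz_on (closure (Omega' R1 R2)) g"
    and f_bounds: "\<exists>c C. 0 < c \<and> (\<forall>x\<in>closure Omega. c \<le> f x \<and> f x \<le> C)"
    and g_bounds: "\<exists>c C. 0 < c \<and> (\<forall>x\<in>closure (Omega' R1 R2). c \<le> g x \<and> g x \<le> C)"
    and equal_mass: "\<forall>\<theta>\<in>{0<..<pi/2}.
          (LINT r:{0<..<1}|lebesgue. f (rcis r \<theta>) * r) =
          (LINT r:{R1 \<theta><..<R2 \<theta>}|lebesgue. g (rcis r \<theta>) * r)"
    and T_transport: "T \<in> transport_maps \<mu> \<nu>"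
    and F_finite: "F R1 R2 \<mu> \<nu> T < \<infinity>"
    and T_profile: "radial_profile T \<phi>"
    and \<Phi>_minimizer: "is_H1_minimizer R1 R2 \<Phi>"
  shows "\<exists>\<psi> :: real \<Rightarrow> real \<Rightarrow> real.
           (AE r in lebesgue. r \<in> {0<..<1} \<longrightarrow>
              (AE \<theta> in lebesgue. \<theta> \<in> {0<..<pi/2} \<longrightarrow> \<psi> r \<theta> = \<phi> r \<theta>)) \<and>
           L2_continuous_on {0..1} \<psi> \<and>
           (AE \<theta> in lebesgue. \<theta> \<in> {0<..<pi/2} \<longrightarrow> \<psi> 0 \<theta> = \<Phi> \<theta>)"
proof -
  let ?Q = "{0<..<1} \<times> angles :: (real \<times> real) set"
  have open_Q: "open ?Q" by (intro open_Times open_greaterThanLessThan)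
  have R1_pos: "\<forall>\<theta>\<in>angles. 0 < R1 \<theta>"
    using R_pos by auto
  have R_cont: "continuous_on {0..pi/2} R1" "continuous_on {0..pi/2} R2"
    using R1_lipschitz R2_lipschitz lipschitz_on_continuous_on by blast+
  have "open (Omega' R1 R2)"
    using R_cont by (intro open_Omega' R1_pos) (auto elim: continuous_on_subset)
  moreover have "continuous_on Omega f" "continuous_on (Omega' R1 R2) g"
    using f_lipschitz g_lipschitz lipschitz_on_continuous_on continuous_on_subset[OF _ closure_subset] by blast+
  moreover have "0 < f x" if "x \<in> Omega" for x
    using f_bounds that closure_subset[of Omega] by force
  ultimately have range: "AE x in lborel. x \<in> Omega \<longrightarrow> T x \<in> Omega' R1 R2"
    using transport_map_range[OF T_transport \<mu>_density \<nu>_density] by blast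
  \<comment> \<open>A finite infimum in \<open>F\<close> only yields some profile of finite energy,
    not the given \<phi>. The argument runs with this one and returns to \<phi> at the end.\<close>
  obtain \<phi>0 where \<phi>0: "radial_profile T \<phi>0"
    and energy: "angular_energy R1 R2 \<phi>0 + radial_energy \<phi>0 < \<infinity>"
    using F_finite unfolding F_def by (auto simp: INF_less_iff split: if_splits)
  then have angular: "angular_energy R1 R2 \<phi>0 < \<infinity>" and "radial_energy \<phi>0 < \<infinity>"
    by auto
  then obtain w where w: "has_weak_derivative (\<lambda>(r, \<theta>). \<phi>0 r \<theta>) w (1, 0) ?Q"
    and w_fin: "(\<integral>\<^sup>+r\<in>{0<..<1}. L2_norm_sq (\<lambda>\<theta>. w (r, \<theta>)) * ennreal r \<partial>lebesgue) < \<infinity>"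
    unfolding radial_energy_def by (auto simp: INF_less_iff)
  have between: "AE p in lborel. p \<in> ?Q \<longrightarrow> R1 (snd p) \<le> \<phi>0 (fst p) (snd p) \<and> \<phi>0 (fst p) (snd p) \<le> R2 (snd p)"
    by (rule radial_profile_between[OF \<phi>0 range R1_pos])
  have u_meas: "(\<lambda>(r, \<theta>). \<phi>0 r \<theta>) \<in> borel_measurable (lebesgue_on ?Q)"
    and w_meas: "w \<in> borel_measurable (lebesgue_on ?Q)"
    using w by (simp_all only: has_weak_derivative_def locally_integrable_on_imp_measurable[OF _ open_Q])
  obtain v where v[measurable]: "v \<in> borel_measurable borel" and v0: "\<And>p. p \<notin> ?Q \<Longrightarrow> v p = 0"
    and v_ae: "AE p in lborel. p \<in> ?Q \<longrightarrow> v p = (case p of (r, \<theta>) \<Rightarrow> \<phi>0 r \<theta>)"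
    using ex_Borel_version[OF u_meas borel_open[OF open_Q]] by blast
  obtain z where z: "z \<in> borel_measurable borel" and z0: "\<And>p. p \<notin> ?Q \<Longrightarrow> z p = 0"
    and z_ae: "AE p in lborel. p \<in> ?Q \<longrightarrow> z p = w p"
    using ex_Borel_version[OF w_meas borel_open[OF open_Q]] by blast
  define Z where "Z r = ennreal r * (\<integral>\<^sup>+\<theta>. ennreal ((z (r, \<theta>))\<^sup>2) \<partial>lborel)" for r
  have z_prod[measurable]: "z \<in> borel_measurable (borel \<Otimes>\<^sub>M borel)"
    using z by (simp add: borel_prod)
  have Z_meas[measurable]: "Z \<in> borel_measurable borel"
    unfolding Z_def[abs_def] by measurable
  have Z_fin: "(\<integral>\<^sup>+r. Z r \<partial>lborel) < \<infinity>"
    using w_fin unfolding Z_def by (subst (asm) radial_energy_Borel_version[OF z z0 z_ae])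
  have z_int: "integrable lborel (\<lambda>p. indicator {\<delta><..} (fst p) * z p)" if "\<delta> > 0" for \<delta>
    by (rule integrable_away_from_0[OF z z0 Z_fin[unfolded Z_def] that])
  have v_int: "integrable lborel v"
  \<comment> \<open>The obstacle constraints give 0 < v \<le> R2 almost everywhere on the rectangle,
    and \<open>R2\<close> is bounded.\<close>
  proof -
    have "bounded (R2 ` {0..pi/2})"
      by (intro compact_imp_bounded compact_continuous_image R_cont compact_Icc)
    then obtain M where M: "\<forall>\<theta>\<in>{0..pi/2}. \<bar>R2 \<theta>\<bar> \<le> M"
      unfolding bounded_iff by auto
    have "emeasure lborel ?Q < \<infinity>"
      using pi_gt_zero by (simp add: lborel_prod[symmetric] lborel.emeasure_pair_measure_Times)
    then have "integrable lborel (\<lambda>p. M * indicator ?Q p)"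
      using borel_open[OF open_Q] by (intro integrable_mult_right integrable_real_indicator) auto
    then show ?thesis
    proof (rule Bochner_Integration.integrable_bound)
      show "AE p in lborel. norm (v p) \<le> norm (M * indicator ?Q p)"
        using v_ae between
      proof eventually_elim
        case (elim p)
        show ?case
        proof (cases "p \<in> ?Q")
          case True
          then have "snd p \<in> angles" by auto
          then have "snd p \<in> {0..pi/2}" "0 < R1 (snd p)" using R1_pos by auto
          then have "\<bar>R2 (snd p)\<bar> \<le> M" "0 < R1 (snd p)" using M by auto
          then show ?thesis
            using True elim by (simp add: case_prod_beta)
        qed (simp add: v0)
      qed
    qed (use v in simp)
  qed
  \<comment> \<open>Since z vanishes for s \<ge> 1, this integrates from r to 1 when r < 1, and the
    function c obtained below is the trace at r = 1.\<close>
  define V where "V r \<theta> = (LINT s|lborel. (if r < s then z (s, \<theta>) else 0))" for r \<theta>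
  have V_meas[measurable]: "(\<lambda>p. V (fst p) (snd p)) \<in> borel_measurable (borel \<Otimes>\<^sub>M borel)"
    unfolding V_def by measurable
  have weak: "(LINT p|lborel. v p * frechet_derivative \<eta> (at p) (1, 0)) = - (LINT p|lborel. z p * \<eta> p)"
    if "test_function ?Q \<eta>" for \<eta>
    by (rule has_weak_derivative_Borel_version[OF w open_Q v v0 v_ae z z0 z_ae that])
  obtain c where c[measurable]: "c \<in> borel_measurable borel"
    and c_ae: "AE p in lborel. p \<in> ?Q \<longrightarrow> v p = c (snd p) - V (fst p) (snd p)"
    using weak_derivative_fst_imp_primitive[of z v 0 "pi/2", OF z v_int z_int weak]
    unfolding V_def by blast
  have \<Phi>_between: "\<Phi> \<in> H1_between R1 R2"
    using \<Phi>_minimizer by (simp add: is_H1_minimizer_def is_arg_min_def)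
  then have \<Phi>_L2: "in_L2 \<Phi>"
    by (intro in_L2_if_H1_norm_sq_finite) (simp add: H1_between_def)
  then obtain \<Phi>' where \<Phi>'[measurable]: "\<Phi>' \<in> borel_measurable borel"
    and \<Phi>'_ae: "AE \<theta> in lborel. \<theta> \<in> angles \<longrightarrow> \<Phi>' \<theta> = \<Phi> \<theta>"
    using ex_Borel_version[OF _ borel_open[OF open_greaterThanLessThan], of \<Phi> 0 "pi/2"]
    unfolding in_L2_def by blast
  \<comment> \<open>The value at 0 is prescribed, so continuity at 0 is what identifies it as the
    limit of the profile.\<close>
  define \<psi> where "\<psi> r \<theta> = (if r \<le> 0 then \<Phi>' \<theta> else c \<theta> - V r \<theta>)" for r \<theta>
  have V_slice[measurable]: "V r \<in> borel_measurable borel" for r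
    unfolding V_def[abs_def] by measurable
  have \<psi>_meas: "\<psi> r \<in> borel_measurable borel" for r
    unfolding \<psi>_def[abs_def] by measurable
  have \<psi>_\<phi>0: "AE r in lborel. r \<in> {0<..<1} \<longrightarrow> (AE \<theta> in lborel. \<theta> \<in> angles \<longrightarrow> \<psi> r \<theta> = \<phi>0 r \<theta>)"
    using AE_lborel_pair[OF c_ae] AE_lborel_pair[OF v_ae]
  proof eventually_elim
    case (elim r)
    show ?case
    proof
      assume r: "r \<in> {0<..<1}"
      show "AE \<theta> in lborel. \<theta> \<in> angles \<longrightarrow> \<psi> r \<theta> = \<phi>0 r \<theta>"
        using elim by eventually_elim (use r in \<open>auto simp: \<psi>_def\<close>)
    qed
  qed
  \<comment> \<open>A Borel function of r equal to the squared distance to \<Phi>.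
    \<open>H1_norm_sq (\<phi>0 r)\<close> is an infimum over weak derivatives with no evident
    measurability in r, so it enters below only as an upper bound under a monotone integral.\<close>
  define G where "G r = (\<integral>\<^sup>+\<theta>. ennreal ((c \<theta> - V r \<theta> - \<Phi>' \<theta>)\<^sup>2) * indicator angles \<theta> \<partial>lborel)" for r
  have G_meas[measurable]: "G \<in> borel_measurable borel"
  proof -
    have "(\<lambda>(r, \<theta>). V r \<theta>) \<in> borel_measurable (borel \<Otimes>\<^sub>M lborel)"
      using V_meas by (simp add: case_prod_beta')
    then show ?thesis
      unfolding G_def[abs_def] by measurable
  qed
  have G: "L2_norm_sq (\<lambda>\<theta>. \<psi> r \<theta> - \<psi> 0 \<theta>) = G r" if "0 < r" for r
    using that unfolding L2_norm_sq_lborel G_def by (simp add: \<psi>_def)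
  have G_fin: "(\<integral>\<^sup>+r\<in>{0<..<1}. G r / ennreal r \<partial>lborel) < \<infinity>"
  proof -
    have "AE r in lborel. ennreal (1/2) * (G r / ennreal r * indicator {0<..<1} r) \<le>
        (H1_norm_sq (\<phi>0 r) - H1_min R1 R2) / ennreal r * indicator {0<..<1} r"
      using \<psi>_\<phi>0 AE_lborel_pair[OF between]
    proof eventually_elim
      case (elim r)
      show ?case
      proof (cases "r \<in> {0<..<1}")
        case True
        have "AE \<theta> in lborel. \<theta> \<in> angles \<longrightarrow> R1 \<theta> \<le> \<phi>0 r \<theta> \<and> \<phi>0 r \<theta> \<le> R2 \<theta>"
          using elim(2) by eventually_elim (use True in auto)
        then have "ennreal (1/2) * L2_norm_sq (\<lambda>\<theta>. \<phi>0 r \<theta> - \<Phi> \<theta>) \<le> H1_norm_sq (\<phi>0 r) - H1_min R1 R2"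
          by (intro L2_norm_sq_diff_minimizer_le[OF \<Phi>_minimizer]) (simp add: AE_completion_iff)
        also have "L2_norm_sq (\<lambda>\<theta>. \<phi>0 r \<theta> - \<Phi> \<theta>) = L2_norm_sq (\<lambda>\<theta>. \<psi> r \<theta> - \<psi> 0 \<theta>)"
        proof (rule L2_norm_sq_cong_AE)
          show "AE \<theta> in lborel. \<theta> \<in> angles \<longrightarrow> \<phi>0 r \<theta> - \<Phi> \<theta> = \<psi> r \<theta> - \<psi> 0 \<theta>"
            using mp[OF elim(1) True] \<Phi>'_ae by eventually_elim (auto simp: \<psi>_def)
        qed
        also have "\<dots> = G r" using True by (intro G) simp
        finally have "ennreal (1/2) * G r / ennreal r \<le> (H1_norm_sq (\<phi>0 r) - H1_min R1 R2) / ennreal r"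
          by (rule divide_right_mono_ennreal)
        then show ?thesis using True by (simp only: ennreal_times_divide indicator_simps mult_1_right)
      qed simp
    qed
    then have "(\<integral>\<^sup>+r. ennreal (1/2) * (G r / ennreal r * indicator {0<..<1} r) \<partial>lborel) \<le> angular_energy R1 R2 \<phi>0"
      unfolding angular_energy_def nn_integral_completion by (rule nn_integral_mono_AE)
    also have "(\<integral>\<^sup>+r. ennreal (1/2) * (G r / ennreal r * indicator {0<..<1} r) \<partial>lborel) =
        ennreal (1/2) * (\<integral>\<^sup>+r\<in>{0<..<1}. G r / ennreal r \<partial>lborel)"
      by (rule nn_integral_cmult) measurable
    finally have "ennreal (1/2) * (\<integral>\<^sup>+r\<in>{0<..<1}. G r / ennreal r \<partial>lborel) < top"
      using angular by (simp only: infinity_ennreal_def)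
    then show ?thesis
      unfolding ennreal_mult_less_top by (auto simp: ennreal_eq_0_iff simp del: ennreal_half)
  qed
  have "L2_continuous_on {0..1} \<psi>"
  proof (rule L2_continuous_on_finite_energy[where Z=Z and h="\<lambda>r. G r / ennreal r"])
    show "L2_norm_sq (\<lambda>\<theta>. \<psi> t \<theta> - \<psi> s \<theta>) \<le> ennreal ((t - s) / s) * (\<integral>\<^sup>+r\<in>{s<..t}. Z r \<partial>lborel)"
      if "0 < s" "s \<le> t" for s t
    proof -
      \<comment> \<open>The unknown c cancels in the difference, and the integral over
        \<open>angles\<close> is enlarged to the whole line.\<close>
      have "L2_norm_sq (\<lambda>\<theta>. \<psi> t \<theta> - \<psi> s \<theta>) \<le> (\<integral>\<^sup>+\<theta>. ennreal ((V s \<theta> - V t \<theta>)\<^sup>2) \<partial>lborel)"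
        unfolding L2_norm_sq_lborel using that
        by (intro nn_integral_mono) (auto simp: \<psi>_def indicator_def)
      also have "\<dots> \<le> ennreal ((t - s) / s) * (\<integral>\<^sup>+r\<in>{s<..t}. Z r \<partial>lborel)"
        unfolding V_def Z_def by (rule primitive_increment_le[OF z z_int that])
      finally show ?thesis .
    qed
    show "L2_norm_sq (\<lambda>\<theta>. \<psi> r \<theta> - \<psi> 0 \<theta>) \<le> ennreal r * (G r / ennreal r)" if "0 < r" for r
      using that by (simp add: G ennreal_times_divide mult.commute[of _ "G r"] ennreal_mult_divide_eq)
    have "L2_norm_sq (\<psi> 0) = L2_norm_sq \<Phi>"
      using \<Phi>'_ae by (intro L2_norm_sq_cong_AE) (simp add: \<psi>_def)
    then show "L2_norm_sq (\<psi> 0) < \<infinity>"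
      using \<Phi>_L2 by (simp add: in_L2_def)
  qed (use \<psi>_meas Z_fin G_fin in \<open>auto intro: Z_meas\<close>)
  moreover have "AE r in lborel. r \<in> {0<..<1} \<longrightarrow> (AE \<theta> in lborel. \<theta> \<in> angles \<longrightarrow> \<psi> r \<theta> = \<phi> r \<theta>)"
    using \<psi>_\<phi>0 AE_lborel_pair[OF radial_profile_unique[OF T_profile \<phi>0]]
  proof eventually_elim
    case (elim r)
    show ?case
    proof
      assume r: "r \<in> {0<..<1}"
      show "AE \<theta> in lborel. \<theta> \<in> angles \<longrightarrow> \<psi> r \<theta> = \<phi> r \<theta>"
        using mp[OF elim(1) r] elim(2) by eventually_elim (use r in auto)
    qed
  qed
  moreover have "AE \<theta> in lborel. \<theta> \<in> angles \<longrightarrow> \<psi> 0 \<theta> = \<Phi> \<theta>"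
    using \<Phi>'_ae by (simp add: \<psi>_def)
  ultimately show ?thesis
    unfolding AE_completion_iff by blast
qed

end
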